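(* Let $k\geq 1$ and $t\geq 1$ be integers. If $G$ is a graph of order $n \geq (10t-1)(k-1)+12t+13$ with $\sigma_t(G)\geq 3kt-t+1$, then $G$ contains $k$ vertex-disjoint chorded cycles. Furthermore, the degree condition is sharp: for every $k\ge 1$, $t\ge 1$ and every sufficiently large $n$, the complete bipartite graph $K_{3k-1,\,n-3k+1}$ satisfies $\sigma_t = t(3k-1) = 3kt-t$ and does not contain $k$ vertex-disjoint chorded cycles.
   Context: All graphs are finite, simple and undirected. A chord of a cycle $C$ is an edge of the graph joining two vertices of $C$ that are not consecutive on $C$; a cycle is chorded if it has at least one chord. For an integer $t\ge 1$, $\sigma_t(G)$ is the minimum of $\sum_{v\in X}\deg_G(v)$ over all independent sets $X$ of $G$ with $|X|=t$, and $\sigma_t(G)=\infty$ if $G$ has no independent set of size $t$. *)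

theory Defs
  imports
    "Graph_Theory.Graph_Theory"
    "HOL-Library.Extended_Nat"
    "HOL-Library.Disjoint_Sets"
begin

text \<open>
  A finite simple undirected graph is a \<open>pair_graph\<close>: a finite, loop-free, symmetric digraph
  without parallel arcs, each edge being represented by its two orientations.  Accordingly the
  degree of a vertex is its out-degree.
\<close>

abbreviation degree :: "'a pair_pre_digraph \<Rightarrow> 'a \<Rightarrow> nat" where
  "degree G v \<equiv> out_degree (with_proj G) v"

definition independent_set :: "'a pair_pre_digraph \<Rightarrow> 'a set \<Rightarrow> bool" where
  "independent_set G X \<longleftrightarrow> X \<subseteq> pverts G \<and> (\<forall>u\<in>X. \<forall>v\<in>X. (u, v) \<notin> parcs G)"

text \<open>
  The values are taken in \<^typ>\<open>enat\<close>, where the infimum of a nonempty set is attained and the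
  infimum of the empty set is \<open>\<infinity>\<close>.
\<close>

definition sigma :: "nat \<Rightarrow> 'a pair_pre_digraph \<Rightarrow> enat" where
  "sigma t G = (INF X \<in> {X. independent_set G X \<and> card X = t}. enat (\<Sum>v\<in>X. degree G v))"

text \<open>
  The library's \<open>cycle\<close> is a list of arcs and also admits the back-and-forth walk along a single
  edge, so the length has to be bounded from below.  Since the walk is closed, the tails
  of its arcs are all of its vertices.
\<close>

definition graph_cycle :: "'a pair_pre_digraph \<Rightarrow> ('a \<times> 'a) list \<Rightarrow> bool" where
  "graph_cycle G p \<longleftrightarrow> pre_digraph.cycle (with_proj G) p \<and> 3 \<le> length p"

definition cycle_verts :: "('a \<times> 'a) list \<Rightarrow> 'a set" where
  "cycle_verts p = fst ` set p"

definition consecutive_on :: "('a \<times> 'a) list \<Rightarrow> 'a \<Rightarrow> 'a \<Rightarrow> bool" where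
  "consecutive_on p u v \<longleftrightarrow> (u, v) \<in> set p \<or> (v, u) \<in> set p"

definition chord :: "'a pair_pre_digraph \<Rightarrow> ('a \<times> 'a) list \<Rightarrow> 'a \<times> 'a \<Rightarrow> bool" where
  "chord G p e \<longleftrightarrow> e \<in> parcs G \<and> fst e \<in> cycle_verts p \<and> snd e \<in> cycle_verts p
     \<and> \<not> consecutive_on p (fst e) (snd e)"

definition chorded_cycle :: "'a pair_pre_digraph \<Rightarrow> ('a \<times> 'a) list \<Rightarrow> bool" where
  "chorded_cycle G p \<longleftrightarrow> graph_cycle G p \<and> (\<exists>e. chord G p e)"

definition has_disjoint_chorded_cycles :: "nat \<Rightarrow> 'a pair_pre_digraph \<Rightarrow> bool" where
  "has_disjoint_chorded_cycles k G \<longleftrightarrow>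
     (\<exists>C. (\<forall>i<k. chorded_cycle G (C i)) \<and> disjoint_family_on (\<lambda>i. cycle_verts (C i)) {..<k})"

text \<open>
  \<open>complete_bipartite_digraph\<close> is a predicate on graphs; every
  complete bipartite graph has a copy with natural numbers as vertices.
\<close>

lemma ex_complete_bipartite: "\<exists>H :: nat pair_pre_digraph. K\<^bsub>a,b\<^esub> (with_proj H)"
proof -
  let ?U = "{..<a}" and ?V = "{a..<a + b}"
  let ?H = "\<lparr> pverts = ?U \<union> ?V, parcs = ?U \<times> ?V \<union> ?V \<times> ?U \<rparr>"
  have "?U \<inter> ?V = {}" "card ?U = a" "card ?V = b" by auto
  then have "K\<^bsub>a,b\<^esub> (with_proj ?H)"
    unfolding complete_bipartite_digraph_pair_def
    by (intro conjI exI[of _ ?U] exI[of _ ?V]) simp_all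
  then show ?thesis by blast
qed

end

(*
  Only the following consequence of the degree sum condition is used: every independent set of
  vertices of degree at most 3k - 1 has fewer than t elements.  It is inherited by G - U, with k - s
  in place of k, whenever every vertex outside U has at most 3s neighbours in U, and one inducts on k.

  - A graph without chorded cycles has at most 12a vertices, where a is the maximum size of an
    independent set of vertices of degree at most 2 (normal spanning forests), so a chorded cycle
    exists.
  - If some chorded cycle has 4 vertices, take a maximum packing of s such 4-sets and keep adding to a
    member any remaining vertex with at least 4 neighbours in it.  A member with 8 vertices would
    split into two chorded 4-cycles, so members stay below 8 vertices; delete their union.
  - Otherwise a shortest chorded cycle C has length l >= 5, and every outside vertex has at most 3
    neighbours in C.  If l < 10t, delete C.  If l >= 10t, all but 4 vertices of C have only two
    neighbours in C, most of them have degree at least 3k, and every outside vertex has at most 2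
    neighbours in C; hence G - C is so large that C can again be deleted.
*)
theory Submission
  imports Defs
begin

section \<open>Chorded cycles from paths\<close>

text \<open>The degree bound drops by exactly 3 per cycle, so a deleted set may receive at most 3
  edges per packed cycle from each vertex left behind. A vertex with four neighbours on a shortest
  chorded cycle of length \<open>l\<close> yields two chorded cycles with \<open>l + 4\<close>
  vertices in total, so \<open>2 * l <= l + 4\<close> and \<open>l = 4\<close>. For 4-cycles such
  vertices do occur (in any large clique), which is why 4-sets are enlarged before they are deleted.

  The constants are a balance. A cycle with fewer than \<open>10 * t\<close> vertices costs at most
  \<open>10 * t - 1\<close>, the slope of the bound in \<open>k\<close>. On a longer one, at least
  \<open>10 * t - 4 - 2 * (t - 1) = 8 * t - 2\<close> vertices send \<open>3 * k - 2\<close> edges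
  out each, at most two of them to the same vertex, so \<open>(3 * k - 2) * (4 * t - 1)\<close>
  vertices remain; for \<open>t = 1\<close> this equals the bound for \<open>k - 1\<close>. The
  summand \<open>12 * t\<close> pays for the existence of one chorded cycle.

  Normality of the forest puts both ends of every edge on one root path, so the absence of chorded
  cycles becomes a restriction on jumps along a path.\<close>

locale simple_graph =
  fixes adj :: "'a \<Rightarrow> 'a \<Rightarrow> bool"
  assumes adj_sym: "adj u v \<Longrightarrow> adj v u"
    and adj_irrefl: "\<not> adj v v"
begin

definition nbrs :: "'a set \<Rightarrow> 'a \<Rightarrow> 'a set" where
  "nbrs V v = {w \<in> V. adj v w}"

definition indep :: "'a set \<Rightarrow> bool" where
  "indep I \<longleftrightarrow> (\<forall>u\<in>I. \<forall>v\<in>I. \<not> adj u v)"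

text \<open>The cycle is written starting from an end \<open>u\<close> of the chord \<open>uv\<close>.\<close>

definition chorded :: "'a set \<Rightarrow> bool" where
  "chorded X \<longleftrightarrow> (\<exists>u as v bs. X = set (u # as @ v # bs) \<and> distinct (u # as @ v # bs)
     \<and> successively adj (u # as @ v # bs) \<and> adj (last bs) u \<and> adj u v \<and> as \<noteq> [] \<and> bs \<noteq> [])"

lemma chordedI:
  assumes "as \<noteq> []" "bs \<noteq> []" "distinct (u # as @ v # bs)"
    "successively adj as" "successively adj bs"
    "adj u (hd as)" "adj (last as) v" "adj v (hd bs)" "adj (last bs) u" "adj u v"
    "X = insert u (insert v (set as \<union> set bs))"
  shows "chorded X"
  unfolding chorded_def
proof (intro exI conjI)
  show "X = set (u # as @ v # bs)" using assms(11) by auto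
  show "successively adj (u # as @ v # bs)"
    using assms by (simp add: successively_append_iff successively_Cons)
qed (use assms in simp_all)

lemma successively_segment:
  assumes "\<And>i. a \<le> i \<Longrightarrow> Suc i < b \<Longrightarrow> adj (f i) (f (Suc i))"
  shows "successively adj (map f [a..<b])"
  unfolding successively_conv_nth using assms by simp

lemma successively_rev_segment:
  assumes "\<And>i. a \<le> i \<Longrightarrow> Suc i < b \<Longrightarrow> adj (f i) (f (Suc i))"
  shows "successively adj (rev (map f [a..<b]))"
proof -
  have "successively (\<lambda>x y. adj y x) (map f [a..<b])"
    unfolding successively_conv_nth using assms adj_sym by simp
  then show ?thesis by (simp only: successively_rev)
qed

lemma distinct_map_inj_on: "inj_on f S \<Longrightarrow> distinct xs \<Longrightarrow> set xs \<subseteq> S \<Longrightarrow> distinct (map f xs)"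
  by (simp add: distinct_map inj_on_subset)

lemma hd_segment: "a < b \<Longrightarrow> hd (map f [a..<b]) = f a"
  by (simp add: hd_map)

lemma last_segment: "a < b \<Longrightarrow> last (map f [a..<b]) = f (b - 1)"
  by (simp add: last_map)

text \<open>The cycle is \<open>w, f a, ..., f c\<close>, and the edge from \<open>w\<close> to
  \<open>f b\<close> is its chord.\<close>

lemma chorded_fan:
  assumes inj: "inj_on f {a..c}" and path: "\<And>i. a \<le> i \<Longrightarrow> i < c \<Longrightarrow> adj (f i) (f (Suc i))"
    and w: "w \<notin> f ` {a..c}" "adj w (f a)" "adj w (f b)" "adj w (f c)" and abc: "a < b" "b < c"
  shows "chorded (insert w (f ` {a..c}))"
proof (rule chordedI)
  let ?as = "map f [a..<b]" and ?bs = "map f [Suc b..<Suc c]"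
  show "?as \<noteq> []" "?bs \<noteq> []" using abc by auto
  have *: "{a..c} = {a..<b} \<union> insert b {Suc b..<Suc c}" using abc by auto
  have "distinct (map f ([a..<b] @ b # [Suc b..<Suc c]))"
    by (rule distinct_map_inj_on[OF inj]) (use * in \<open>auto simp del: upt_Suc\<close>)
  moreover have "w \<notin> set (map f ([a..<b] @ b # [Suc b..<Suc c]))"
    using w(1) abc by auto
  ultimately show "distinct (w # ?as @ f b # ?bs)" by (simp del: upt_Suc)
  show "insert w (f ` {a..c}) = insert w (insert (f b) (set ?as \<union> set ?bs))"
    unfolding * by auto
  show "successively adj ?as" "successively adj ?bs"
    using path abc by (auto intro!: successively_segment simp del: upt_Suc)
  show "adj w (hd ?as)" "adj (last ?bs) w" "adj w (f b)"
    using abc w adj_sym by (auto simp: hd_segment last_map)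
  show "adj (last ?as) (f b)" using path[of "b - 1"] abc by (simp add: last_segment)
  show "adj (f b) (hd ?bs)" using path[of b] abc by (simp add: hd_map del: upt_Suc)
qed

lemma chorded_cycle_chord:
  assumes inj: "inj_on f {a..c}" and path: "\<And>i. a \<le> i \<Longrightarrow> i < c \<Longrightarrow> adj (f i) (f (Suc i))"
    and closed: "adj (f a) (f c)" and chord: "adj (f i) (f j)"
    and ij: "a \<le> i" "Suc i < j" "j \<le> c" "\<not> (i = a \<and> j = c)"
  shows "chorded (f ` {a..c})"
proof (rule chordedI)
  \<comment> \<open>From \<open>f i\<close> the cycle runs up to \<open>f j\<close>, on to
    \<open>f c\<close>, over the closing edge to \<open>f a\<close> and up to \<open>f i\<close>
    again. A piece of \<open>?bs\<close> is empty if \<open>j = c\<close> or \<open>i = a\<close>;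
    \<open>ij(4)\<close> excludes that both are.\<close>
  let ?as = "map f [Suc i..<j]" and ?bs = "map f [Suc j..<Suc c] @ map f [a..<i]"
  show "?as \<noteq> []" using ij by simp
  show "?bs \<noteq> []" using ij by simp linarith
  have *: "{a..c} = insert i ({Suc i..<j} \<union> insert j ({Suc j..<Suc c} \<union> {a..<i}))" using ij by auto
  have "distinct (map f (i # [Suc i..<j] @ j # [Suc j..<Suc c] @ [a..<i]))"
    by (rule distinct_map_inj_on[OF inj]) (use * ij in \<open>auto simp del: upt_Suc\<close>)
  then show "distinct (f i # ?as @ f j # ?bs)" by (simp del: upt_Suc)
  show "f ` {a..c} = insert (f i) (insert (f j) (set ?as \<union> set ?bs))"
    unfolding * by auto
  show "successively adj ?as" using path ij by (auto intro!: successively_segment)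
  have "successively adj (map f [Suc j..<Suc c])" "successively adj (map f [a..<i])"
    using path ij by (auto intro!: successively_segment simp del: upt_Suc)
  moreover have "adj (last (map f [Suc j..<Suc c])) (hd (map f [a..<i]))" if "j < c" "a < i"
    using that closed adj_sym by (simp add: hd_map last_map)
  ultimately show "successively adj ?bs"
    unfolding successively_append_iff by (cases "j < c"; cases "a < i") (auto simp del: upt_Suc)
  show "adj (f i) (hd ?as)" using path[of i] ij by (simp add: hd_map)
  show "adj (last ?as) (f j)" using path[of "j - 1"] ij by (simp add: last_map)
  show "adj (f j) (hd ?bs)"
  proof (cases "j < c")
    case True
    then show ?thesis using path[of j] ij by (simp add: hd_append hd_map del: upt_Suc)
  next
    case False
    then have "j = c" "a < i" using ij by auto
    then show ?thesis using closed adj_sym by (simp add: hd_map)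
  qed
  show "adj (last ?bs) (f i)"
  proof (cases "a < i")
    case True
    then show ?thesis using path[of "i - 1"] ij by (simp add: last_map)
  next
    case False
    then have "i = a" "j < c" using ij by auto
    then show ?thesis using closed adj_sym by (simp add: last_map)
  qed
  show "adj (f i) (f j)" by fact
qed

text \<open>With \<open>i + 1\<close> jumping up and \<open>i\<close> jumping down, the path edge between them becomes a chord.\<close>

lemma chorded_up_down:
  assumes inj: "inj_on f {..c}" and path: "\<And>i. i < c \<Longrightarrow> adj (f i) (f (Suc i))"
    and up: "adj (f (Suc i)) (f a)" "a < i" and down: "adj (f i) (f c)" "Suc i < c"
  shows "chorded (f ` {a..c})"
proof (rule chordedI)
  \<comment> \<open>From \<open>f i\<close> jump to \<open>f c\<close>, walk back to
    \<open>f (Suc i)\<close>, jump to \<open>f a\<close>, walk up to \<open>f i\<close>.\<close>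
  let ?as = "rev (map f [Suc (Suc i)..<Suc c])" and ?bs = "map f [a..<i]"
  show "?as \<noteq> []" "?bs \<noteq> []" using assms by auto
  have *: "{a..c} = insert i (insert (Suc i) ({Suc (Suc i)..<Suc c} \<union> {a..<i}))" using assms by auto
  have "distinct (map f (i # rev [Suc (Suc i)..<Suc c] @ Suc i # [a..<i]))"
    by (rule distinct_map_inj_on[OF inj]) (use up down in \<open>auto simp del: upt_Suc\<close>)
  then show "distinct (f i # ?as @ f (Suc i) # ?bs)" by (simp add: rev_map del: upt_Suc)
  show "f ` {a..c} = insert (f i) (insert (f (Suc i)) (set ?as \<union> set ?bs))"
    unfolding * by (auto simp del: upt_Suc)
  show "successively adj ?as" by (intro successively_rev_segment) (use path down in auto)
  show "successively adj ?bs" using path down up by (auto intro!: successively_segment)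
  show "adj (f i) (hd ?as)" using down by (simp add: hd_rev last_map)
  show "adj (last ?as) (f (Suc i))" using path[of "Suc i"] adj_sym down
    by (simp add: last_rev hd_map del: upt_Suc)
  show "adj (f (Suc i)) (hd ?bs)" using up by (simp add: hd_map)
  show "adj (last ?bs) (f i)" using path[of "i - 1"] up down by (simp add: last_map)
  show "adj (f i) (f (Suc i))" using path[of i] down by simp
qed

text \<open>If the jumps from two consecutive vertices are nested (\<open>b <= a\<close> or
  \<open>c <= b\<close>), the outer one closes a cycle with the inner one as chord. Otherwise all
  three jumps are used: \<open>d\<close>, \<open>a\<close> to \<open>b\<close>,
  \<open>d + 1\<close>, \<open>d + 2\<close>, \<open>c\<close> to \<open>d - 1\<close> is a cycle,
  and the path edge between \<open>d\<close> and \<open>d + 1\<close> is its chord.\<close>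

lemma chorded_three_ups:
  assumes inj: "inj_on f {..d + 2}" and path: "\<And>i. i < d + 2 \<Longrightarrow> adj (f i) (f (Suc i))"
    and up: "adj (f d) (f a)" "Suc a < d" "adj (f (d + 1)) (f b)" "b < d" "adj (f (d + 2)) (f c)" "c < d + 1"
  shows "\<exists>X \<subseteq> f ` {..d + 2}. chorded X"
proof (cases "a < b \<and> b < c")
  case False
  show ?thesis
  proof (cases "b \<le> a")
    case True
    have "chorded (f ` {b..d + 1})"
      by (rule chorded_cycle_chord[where i = a and j = d])
        (use up True path adj_sym in \<open>auto intro: inj_on_subset[OF inj]\<close>)
    then show ?thesis by (rule exI[where x = "f ` {b..d + 1}", OF conjI, rotated]) auto
  next
    case b: False
    then have "c \<le> b" using False by auto
    have "chorded (f ` {c..d + 2})"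
      by (rule chorded_cycle_chord[where i = b and j = "d + 1"])
        (use up \<open>c \<le> b\<close> path adj_sym in \<open>auto intro: inj_on_subset[OF inj]\<close>)
    then show ?thesis by (rule exI[where x = "f ` {c..d + 2}", OF conjI, rotated]) auto
  qed
next
  case True
  let ?as = "map f [a..<Suc b]" and ?bs = "map f ((d + 2) # [c..<d])"
  have "chorded (insert (f d) (insert (f (d + 1)) (set ?as \<union> set ?bs)))"
  proof (rule chordedI[OF _ _ _ _ _ _ _ _ _ _ refl])
    show "?as \<noteq> []" "?bs \<noteq> []" using True by auto
    have "distinct (map f (d # [a..<Suc b] @ (d + 1) # (d + 2) # [c..<d]))"
      by (rule distinct_map_inj_on[OF inj]) (use True up in \<open>auto simp del: upt_Suc\<close>)
    then show "distinct (f d # ?as @ f (d + 1) # ?bs)" by (simp del: upt_Suc)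
    show "successively adj ?as" using path up by (auto intro!: successively_segment simp del: upt_Suc)
    show "successively adj ?bs" using path up
      by (auto intro!: successively_segment simp: successively_Cons hd_map)
    show "adj (f d) (hd ?as)" using up True by (simp add: hd_map del: upt_Suc)
    show "adj (last ?as) (f (d + 1))" using up True adj_sym by (simp add: last_map)
    show "adj (f (d + 1)) (hd ?bs)" using path[of "d + 1"] by simp
    \<comment> \<open>For \<open>c = d\<close> the segment is empty and \<open>f (d + 2)\<close>
      itself is adjacent to \<open>f d\<close>.\<close>
    show "adj (last ?bs) (f d)" using path[of "d - 1"] up adj_sym
      by (cases "c < d") (auto simp: last_map less_Suc_eq)
    show "adj (f d) (f (d + 1))" using path[of d] by simp
  qed
  then show ?thesis
    by (rule exI[where x = "insert (f d) (insert (f (d + 1)) (set ?as \<union> set ?bs))", OF conjI, rotated])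
      (use True up in \<open>auto simp del: upt_Suc\<close>)
qed

end

section \<open>Normal forests\<close>

context simple_graph begin

text \<open>A rooted forest on \<open>V\<close> is encoded by the path \<open>P v\<close> from the root to \<open>v\<close>.\<close>

definition forest :: "'a set \<Rightarrow> ('a \<Rightarrow> 'a list) \<Rightarrow> bool" where
  "forest V P \<longleftrightarrow> (\<forall>v\<in>V. P v \<noteq> [] \<and> last (P v) = v \<and> distinct (P v) \<and> set (P v) \<subseteq> V
     \<and> successively adj (P v) \<and> (\<forall>i<length (P v). P (P v ! i) = take (Suc i) (P v)))"

text \<open>Hanging the subtree of \<open>v\<close> below \<open>u\<close> lowers each of its
  vertices by \<open>length (P u) + 1 - length (P v)\<close> levels, a positive number, and changes
  no other root path. As \<open>v\<close> is no ancestor of \<open>u\<close>, the new root paths do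
  not repeat vertices.\<close>

lemma forest_reattach:
  assumes P: "forest V P" and uv: "u \<in> V" "v \<in> V" "adj u v" "v \<notin> set (P u)" "u \<notin> set (P v)"
    and len: "length (P v) \<le> length (P u)" and fin: "finite V"
  shows "\<exists>P'. forest V P' \<and> (\<Sum>x\<in>V. length (P x)) < (\<Sum>x\<in>V. length (P' x))"
proof -
  \<comment> \<open>The position of \<open>v\<close> on every root path through \<open>v\<close>
    (see \<open>idx\<close>), so \<open>drop n\<close> keeps the part from \<open>v\<close>
    on.\<close>
  define n where "n = length (P v) - 1"
  define P' where "P' x = (if v \<in> set (P x) then P u @ drop n (P x) else P x)" for x
  have Pv: "P x \<noteq> []" "last (P x) = x" "distinct (P x)" "set (P x) \<subseteq> V" "successively adj (P x)"
    and pre: "\<And>i. i < length (P x) \<Longrightarrow> P (P x ! i) = take (Suc i) (P x)" if "x \<in> V" for x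
    using P that unfolding forest_def by auto
  have idx: "n < length (P x)" "P x ! n = v" if x: "x \<in> V" "v \<in> set (P x)" for x
  proof -
    obtain i where i: "i < length (P x)" "P x ! i = v" using x by (auto simp: in_set_conv_nth)
    then have "P v = take (Suc i) (P x)" using pre[OF x(1)] by blast
    then have "n = i" unfolding n_def using i by simp
    then show "n < length (P x)" "P x ! n = v" using i by auto
  qed
  have desc: "v \<in> set (P (P x ! j))" if x: "x \<in> V" "v \<in> set (P x)" "n \<le> j" "j < length (P x)" for x j
  proof -
    have "v = take (Suc j) (P x) ! n" using idx[OF x(1,2)] x(3) by simp
    moreover have "n < length (take (Suc j) (P x))" using x(3) idx[OF x(1,2)] by simp
    ultimately have "v \<in> set (take (Suc j) (P x))" by (metis nth_mem)
    then show ?thesis using pre[OF x(1,4)] by simp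
  qed
  have anc: "v \<notin> set (P y)" if "x \<in> V" "v \<notin> set (P x)" "y \<in> set (P x)" for x y
  proof
    assume v: "v \<in> set (P y)"
    obtain i where "i < length (P x)" "P x ! i = y" using \<open>y \<in> _\<close> by (auto simp: in_set_conv_nth)
    then have "P y = take (Suc i) (P x)" using pre[OF \<open>x \<in> V\<close>] by blast
    then show False using v that(2) by (metis in_set_takeD)
  qed
  have "forest V P'" unfolding forest_def
  proof (intro ballI)
    fix x assume x: "x \<in> V"
    show "P' x \<noteq> [] \<and> last (P' x) = x \<and> distinct (P' x) \<and> set (P' x) \<subseteq> V
      \<and> successively adj (P' x) \<and> (\<forall>i<length (P' x). P' (P' x ! i) = take (Suc i) (P' x))"
    proof (cases "v \<in> set (P x)")
      case False
      have "P' (P x ! i) = take (Suc i) (P x)" if "i < length (P x)" for i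
        using that pre[OF x that] anc[OF x False, of "P x ! i"] by (simp add: P'_def)
      then show ?thesis using Pv[OF x] False by (simp add: P'_def)
    next
      case True
      note n = idx[OF x True]
      have P'x: "P' x = P u @ drop n (P x)" using True by (simp add: P'_def)
      \<comment> \<open>A common vertex would have \<open>v\<close> on its root path and lie on the
        path to \<open>u\<close>, so \<open>v\<close> would lie on the path to
        \<open>u\<close>.\<close>
      have disj: "set (P u) \<inter> set (drop n (P x)) = {}"
      proof (rule ccontr)
        assume "set (P u) \<inter> set (drop n (P x)) \<noteq> {}"
        then obtain y where y: "y \<in> set (P u)" "y \<in> set (drop n (P x))" by auto
        then obtain j where "j < length (drop n (P x))" "drop n (P x) ! j = y"
          by (auto simp: in_set_conv_nth)
        then have "v \<in> set (P y)" using desc[OF x True, of "n + j"] by auto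
        then show False using anc[OF uv(1,4) y(1)] by blast
      qed
      have "P' (P' x ! i) = take (Suc i) (P' x)" if i: "i < length (P' x)" for i
      proof (cases "i < length (P u)")
        case True
        then have "v \<notin> set (P (P u ! i))" using anc[OF uv(1,4)] by auto
        then show ?thesis using True pre[OF uv(1) True] by (simp add: P'x nth_append P'_def[of "P u ! i"])
      next
        case False
        define j where "j = n + (i - length (P u))"
        have j: "n \<le> j" "j < length (P x)" "P' x ! i = P x ! j"
          using False i n by (auto simp: j_def P'x nth_append)
        have "P' (P x ! j) = P u @ drop n (take (Suc j) (P x))"
          using desc[OF x True j(1,2)] pre[OF x j(2)] by (simp add: P'_def)
        also have "\<dots> = take (Suc i) (P' x)"
          using False by (simp add: P'x j_def drop_take Suc_diff_le)
        finally show ?thesis using j by simp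
      qed
      moreover have "successively adj (P' x)"
      proof -
        have "successively adj (drop n (P x))"
          using Pv(5)[OF x] by (metis append_take_drop_id successively_append_iff)
        then show ?thesis using Pv[OF uv(1)] uv(3) n
          by (simp add: P'x successively_append_iff hd_drop_conv_nth)
      qed
      moreover have "P' x \<noteq> []" "last (P' x) = x" using n Pv[OF x] by (simp_all add: P'x)
      moreover have "distinct (P' x)" using Pv(3)[OF x] Pv(3)[OF uv(1)] disj by (simp add: P'x)
      moreover have "set (P' x) \<subseteq> V"
        using Pv(4)[OF x] Pv(4)[OF uv(1)] set_drop_subset[of n "P x"] by (auto simp: P'x)
      ultimately show ?thesis by blast
    qed
  qed
  moreover have "(\<Sum>x\<in>V. length (P x)) < (\<Sum>x\<in>V. length (P' x))"
  proof (rule sum_strict_mono_ex1[OF fin])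
    have "n < length (P v)" using Pv[OF uv(2)] by (cases "P v") (auto simp: n_def)
    then have "n < length (P u)" using len by simp
    then show "\<forall>x\<in>V. length (P x) \<le> length (P' x)" using idx by (auto simp: P'_def)
    have "v \<in> set (P v)" using Pv[OF uv(2)] by (metis last_in_set)
    then have "length (P' v) = length (P u) + 1" using \<open>n < length (P v)\<close>
      by (simp add: P'_def n_def)
    then show "\<exists>x\<in>V. length (P x) < length (P' x)" using uv len by (intro bexI[of _ v]) auto
  qed
  ultimately show ?thesis by blast
qed

text \<open>A forest maximising the total depth is normal, since otherwise \<open>forest_reattach\<close> applies.\<close>

lemma ex_normal_forest:
  assumes fin: "finite V"
  obtains P where "forest V P" "\<And>u v. u \<in> V \<Longrightarrow> v \<in> V \<Longrightarrow> adj u v \<Longrightarrow> u \<in> set (P v) \<or> v \<in> set (P u)"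
proof -
  let ?s = "\<lambda>P. \<Sum>x\<in>V. length (P x :: 'a list)"
  have "forest V (\<lambda>v. [v])" unfolding forest_def by auto
  moreover have "?s P \<le> card V * card V" if "forest V P" for P
  proof -
    have "length (P x) \<le> card V" if "x \<in> V" for x
      using \<open>forest V P\<close> that fin unfolding forest_def by (metis card_mono distinct_card)
    then show ?thesis using sum_bounded_above[of V "\<lambda>x. length (P x)" "card V"] by simp
  qed
  ultimately have "\<exists>P. forest V P \<and> (\<forall>P'. forest V P' \<longrightarrow> ?s P' \<le> ?s P)"
    by (intro ex_has_greatest_nat[where b = "Suc (card V * card V)"]) (auto simp: less_Suc_eq_le)
  then obtain P where P: "forest V P" "\<And>P'. forest V P' \<Longrightarrow> ?s P' \<le> ?s P" by auto
  show thesis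
  proof (rule that[OF P(1)])
    fix u v assume uv: "u \<in> V" "v \<in> V" "adj u v"
    show "u \<in> set (P v) \<or> v \<in> set (P u)"
    proof (rule ccontr)
      assume c: "\<not> ?thesis"
      have "\<exists>P'. forest V P' \<and> ?s P < ?s P'"
      proof (cases "length (P v) \<le> length (P u)")
        case True
        then show ?thesis using forest_reattach[OF P(1) uv _ _ _ fin] c by blast
      next
        case False
        then show ?thesis using forest_reattach[OF P(1) uv(2,1) adj_sym[OF uv(3)] _ _ _ fin] c by simp
      qed
      then show False using P(2) by (meson leD)
    qed
  qed
qed

end

section \<open>Independent vertices of low degree in graphs without chorded cycles\<close>

lemma sum_card_swap:
  assumes "finite A" "finite B"
  shows "(\<Sum>x\<in>A. card {y \<in> B. R x y}) = (\<Sum>y\<in>B. card {x \<in> A. R x y})"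
proof -
  have "(\<Sum>x\<in>A. card {y \<in> B. R x y}) = (\<Sum>x\<in>A. \<Sum>y\<in>B. if R x y then 1 else 0)"
    using assms by (simp add: sum.If_cases Int_def)
  also have "\<dots> = (\<Sum>y\<in>B. \<Sum>x\<in>A. if R x y then 1 else 0)" by (rule sum.swap)
  also have "\<dots> = (\<Sum>y\<in>B. card {x \<in> A. R x y})"
    using assms by (simp add: sum.If_cases Int_def)
  finally show ?thesis .
qed

locale chordless_forest = simple_graph adj for adj :: "'a \<Rightarrow> 'a \<Rightarrow> bool" +
  fixes V :: "'a set" and P :: "'a \<Rightarrow> 'a list"
  assumes fin: "finite V" and forest: "forest V P"
    and normal: "u \<in> V \<Longrightarrow> v \<in> V \<Longrightarrow> adj u v \<Longrightarrow> u \<in> set (P v) \<or> v \<in> set (P u)"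
    and chordless: "X \<subseteq> V \<Longrightarrow> \<not> chorded X"
begin

section \<open>Depths, parents and back edges of a normal forest\<close>

definition depth :: "'a \<Rightarrow> nat" where "depth v = length (P v)"
text \<open>A root has depth 1, and truncated subtraction makes it its own parent; hence the guard
  \<open>2 <= depth v\<close>, saying that \<open>v\<close> is not a root, in
  \<open>children\<close> and \<open>backs\<close>.\<close>

definition par :: "'a \<Rightarrow> 'a" where "par v = P v ! (depth v - 2)"
definition children :: "'a \<Rightarrow> 'a set" where "children p = {v \<in> V. 2 \<le> depth v \<and> par v = p}"
definition up :: "'a \<Rightarrow> 'a set" where "up v = {w \<in> V. adj v w \<and> w \<in> set (P v)}"
definition down :: "'a \<Rightarrow> 'a set" where "down v = {w \<in> V. adj v w \<and> v \<in> set (P w)}"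
text \<open>The lower ends of the edges outside the forest. By \<open>up_unique\<close> each carries
  just one such edge, so \<open>card backs\<close> counts these edges.\<close>

definition backs :: "'a set" where "backs = {v \<in> V. 2 \<le> depth v \<and> (\<exists>w\<in>up v. w \<noteq> par v)}"

lemma P_simps:
  assumes "v \<in> V"
  shows "P v \<noteq> []" "last (P v) = v" "distinct (P v)" "set (P v) \<subseteq> V" "successively adj (P v)"
    "i < depth v \<Longrightarrow> P (P v ! i) = take (Suc i) (P v)"
  using forest assms unfolding forest_def depth_def by blast+

lemma depth_pos: "v \<in> V \<Longrightarrow> 0 < depth v"
  using P_simps(1) by (auto simp: depth_def)

lemma nth_last: "v \<in> V \<Longrightarrow> P v ! (depth v - 1) = v"
  using P_simps(1,2) by (metis depth_def last_conv_nth)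

lemma nth_in: "v \<in> V \<Longrightarrow> i < depth v \<Longrightarrow> P v ! i \<in> V"
  using P_simps(4)[of v] nth_mem[of i "P v"] unfolding depth_def by blast

lemma depth_nth: "v \<in> V \<Longrightarrow> i < depth v \<Longrightarrow> depth (P v ! i) = Suc i"
  using P_simps(6) unfolding depth_def by simp

lemma nth_nth: "v \<in> V \<Longrightarrow> i < depth v \<Longrightarrow> j \<le> i \<Longrightarrow> P (P v ! i) ! j = P v ! j"
  using P_simps(6) by simp

lemma inj_P: "v \<in> V \<Longrightarrow> inj_on ((!) (P v)) {..<depth v}"
  using P_simps(3) unfolding depth_def by (auto intro: inj_on_nth)

lemma path_P: "v \<in> V \<Longrightarrow> Suc i < depth v \<Longrightarrow> adj (P v ! i) (P v ! Suc i)"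
  using P_simps(5) unfolding depth_def successively_conv_nth by blast

lemma ancestorE:
  assumes "v \<in> V" "w \<in> set (P v)"
  obtains i where "i < depth v" "w = P v ! i" "depth w = Suc i"
proof -
  obtain i where i: "i < depth v" "w = P v ! i"
    using assms(2) unfolding depth_def in_set_conv_nth by blast
  then show thesis using that depth_nth[OF assms(1)] by blast
qed

lemma ancestor_depth:
  assumes "v \<in> V" "w \<in> set (P v)" "w \<noteq> v"
  shows "depth w < depth v"
proof -
  obtain i where i: "i < depth v" "w = P v ! i" "depth w = Suc i" using ancestorE[OF assms(1,2)] .
  then have "i \<noteq> depth v - 1" using nth_last[OF assms(1)] assms(3) by blast
  then show "depth w < depth v" using i by simp
qed

lemma par_props:
  assumes v: "v \<in> V" "2 \<le> depth v"
  shows "par v \<in> V" "adj v (par v)" "depth (par v) = depth v - 1" "v \<in> children (par v)"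
    "par v \<in> set (P v)"
proof -
  show "par v \<in> V" using nth_in v by (simp add: par_def)
  have "Suc (depth v - 2) = depth v - 1" using v by simp
  then show "adj v (par v)" using adj_sym[OF path_P[OF v(1), of "depth v - 2"]] v nth_last[OF v(1)]
    by (simp add: par_def)
  show "depth (par v) = depth v - 1" using depth_nth[OF v(1), of "depth v - 2"] v by (simp add: par_def)
  show "v \<in> children (par v)" using v by (simp add: children_def)
  show "par v \<in> set (P v)" using v by (simp add: par_def depth_def)
qed

text \<open>Positions count from 0 and depths from 1, so \<open>P w ! depth v\<close> is the vertex
  just below \<open>v\<close> on the way to \<open>w\<close>.\<close>

lemma child_on_path:
  assumes "w \<in> V" "v \<in> set (P w)" "v \<noteq> w"
  shows "depth v < depth w" "P w ! (depth v - 1) = v" "P w ! depth v \<in> children v"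
proof -
  obtain i where i: "i < depth w" "v = P w ! i" "depth v = Suc i" using ancestorE[OF assms(1,2)] .
  show *: "depth v < depth w" using ancestor_depth assms by blast
  show "P w ! (depth v - 1) = v" using i by simp
  have "depth (P w ! Suc i) = Suc (Suc i)" using * i depth_nth assms by simp
  moreover have "par (P w ! Suc i) = v" using * i nth_nth[OF assms(1), of "Suc i" i]
    by (simp add: par_def calculation)
  ultimately show "P w ! depth v \<in> children v" using nth_in[OF assms(1)] * i by (simp add: children_def)
qed

lemma up_nth:
  assumes "v \<in> V" "w \<in> up v" "w \<noteq> par v"
  obtains j where "Suc (Suc j) < depth v" "w = P v ! j"
proof -
  have w: "w \<in> set (P v)" "adj v w" using assms by (auto simp: up_def)
  then obtain i where i: "i < depth v" "w = P v ! i" using ancestorE[OF assms(1)] by blast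
  have "i \<noteq> depth v - 1" using nth_last[OF assms(1)] w adj_irrefl i by auto
  moreover have "i \<noteq> depth v - 2" using assms i by (auto simp: par_def)
  ultimately show thesis using i that by force
qed

lemma backE:
  assumes "v \<in> backs"
  obtains j where "v \<in> V" "Suc (Suc j) < depth v" "adj v (P v ! j)"
proof -
  have v: "v \<in> V" using assms by (simp add: backs_def)
  obtain w where w: "w \<in> up v" "w \<noteq> par v" using assms by (auto simp: backs_def)
  obtain j where "Suc (Suc j) < depth v" "w = P v ! j" using up_nth[OF v w] .
  then show thesis using that v w by (auto simp: up_def)
qed

text \<open>Two back edges at \<open>v\<close> together with the edge to its parent form a fan over
  the path from the higher end to the parent, hence a chorded cycle.\<close>

lemma up_unique:
  assumes v: "v \<in> V" and w: "w \<in> up v" "w \<noteq> par v" "w' \<in> up v" "w' \<noteq> par v"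
  shows "w = w'"
proof -
  have *: "\<not> a < b" if ab: "Suc (Suc b) < depth v" "adj v (P v ! a)" "adj v (P v ! b)" for a b
  proof
    assume "a < b"
    let ?f = "(!) (P v)"
    have d: "2 \<le> depth v" using ab by simp
    have "chorded (insert v (?f ` {a..depth v - 2}))"
    proof (rule chorded_fan)
      show "inj_on ?f {a..depth v - 2}" by (rule inj_on_subset[OF inj_P[OF v]]) (use d in auto)
      show "adj v (?f a)" "adj v (?f b)" by fact+
      show "adj v (?f (depth v - 2))" using par_props(2)[OF v d] by (simp add: par_def)
      show "v \<notin> ?f ` {a..depth v - 2}"
      proof
        assume "v \<in> ?f ` {a..depth v - 2}"
        then obtain i where "i \<le> depth v - 2" "v = P v ! i" by auto
        then have "i < depth v" "depth v = Suc i" using depth_nth[OF v, of i] d by auto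
        then show False using \<open>i \<le> depth v - 2\<close> d by simp
      qed
    qed (use ab \<open>a < b\<close> path_P[OF v] in auto)
    moreover have "insert v (?f ` {a..depth v - 2}) \<subseteq> V" using v nth_in[OF v] d by auto
    ultimately show False using chordless by blast
  qed
  obtain a where "Suc (Suc a) < depth v" "w = P v ! a" using up_nth[OF v w(1,2)] .
  moreover obtain b where "Suc (Suc b) < depth v" "w' = P v ! b" using up_nth[OF v w(3,4)] .
  moreover have "adj v w" "adj v w'" using w by (auto simp: up_def)
  ultimately show ?thesis using *[of a b] *[of b a] by (metis nat_neq_iff)
qed

lemma card_up:
  assumes v: "v \<in> V"
  shows "card (up v) = (if 2 \<le> depth v then 1 else 0) + (if v \<in> backs then 1 else 0)"
proof (cases "2 \<le> depth v")
  case False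
  have "up v = {}"
  proof (rule ccontr)
    assume "up v \<noteq> {}"
    then obtain w where w: "w \<in> set (P v)" "adj v w" by (auto simp: up_def)
    then have "w \<noteq> v" using adj_irrefl by auto
    then have "depth w < depth v" using ancestor_depth v w by blast
    moreover have "0 < depth w" using depth_pos P_simps(4)[OF v] w by blast
    ultimately show False using False by simp
  qed
  then show ?thesis using False by (simp add: backs_def)
next
  case True
  have p: "par v \<in> up v" using par_props[OF v True] by (simp add: up_def)
  show ?thesis
  proof (cases "v \<in> backs")
    case b: True
    then obtain w where w: "w \<in> up v" "w \<noteq> par v" by (auto simp: backs_def)
    have "up v = {par v, w}" using up_unique[OF v _ _ w] p w by blast
    then show ?thesis using True b w by simp
  next
    case False
    then have "\<And>w. w \<in> up v \<Longrightarrow> w = par v" using v True unfolding backs_def by blast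
    then have "up v = {par v}" using p by blast
    then show ?thesis using False True by simp
  qed
qed

lemma nbrs_up_down:
  assumes "v \<in> V"
  shows "nbrs V v = up v \<union> down v" "up v \<inter> down v = {}"
proof -
  show "nbrs V v = up v \<union> down v" using normal assms by (auto simp: nbrs_def up_def down_def)
  show "up v \<inter> down v = {}"
  proof (rule ccontr)
    assume "up v \<inter> down v \<noteq> {}"
    then obtain w where w: "w \<in> V" "adj v w" "w \<in> set (P v)" "v \<in> set (P w)" by (auto simp: up_def down_def)
    then have "w \<noteq> v" using adj_irrefl by auto
    then show False using ancestor_depth w assms by (metis less_asym)
  qed
qed

lemma finite_sets [simp]: "finite (up v)" "finite (down v)" "finite (children v)" "finite backs"
  using fin by (simp_all add: up_def down_def children_def backs_def)

lemma card_nbrs: "v \<in> V \<Longrightarrow> card (nbrs V v) = card (up v) + card (down v)"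
  using nbrs_up_down by (simp add: card_Un_disjoint)

lemma children_down: "children v \<subseteq> down v"
proof
  fix w assume "w \<in> children v"
  then have w: "w \<in> V" "2 \<le> depth w" "par w = v" by (auto simp: children_def)
  show "w \<in> down v" using par_props(2,5)[OF w(1,2)] adj_sym w by (simp add: down_def)
qed

text \<open>Seen from its lower end, an edge is either the parent edge of a non-root or the single
  back edge of a vertex in \<open>backs\<close>.\<close>

lemma sum_deg: "(\<Sum>v\<in>V. card (nbrs V v)) = 2 * (card {v \<in> V. 2 \<le> depth v} + card backs)"
proof -
  have "V \<inter> {v. v \<in> backs} = backs" by (auto simp: backs_def)
  then have "(\<Sum>v\<in>V. card (up v)) = card {v \<in> V. 2 \<le> depth v} + card backs"
    using fin by (simp add: card_up sum.distrib sum.If_cases) (simp add: Int_def)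
  moreover have "(\<Sum>v\<in>V. card (down v)) = (\<Sum>v\<in>V. card (up v))"
  proof -
    have "(\<Sum>v\<in>V. card (down v)) = (\<Sum>v\<in>V. card {w \<in> V. adj w v \<and> v \<in> set (P w)})"
      unfolding down_def by (intro sum.cong refl arg_cong[of _ _ card]) (use adj_sym in blast)
    also have "\<dots> = (\<Sum>w\<in>V. card (up w))"
      unfolding up_def by (rule sum_card_swap[OF fin fin])
    finally show ?thesis .
  qed
  ultimately show ?thesis by (simp add: card_nbrs sum.distrib)
qed

lemma sum_children: "(\<Sum>v\<in>V. card (children v)) = card {v \<in> V. 2 \<le> depth v}"
proof -
  have "(\<Sum>v\<in>V. card (children v)) = (\<Sum>w\<in>V. card {v \<in> V. 2 \<le> depth w \<and> par w = v})"
    unfolding children_def by (rule sum_card_swap[OF fin fin])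
  also have "\<dots> = (\<Sum>w\<in>V. if 2 \<le> depth w then 1 else 0)"
  proof (rule sum.cong[OF refl])
    fix w assume w: "w \<in> V"
    have "{v \<in> V. 2 \<le> depth w \<and> par w = v} = (if 2 \<le> depth w then {par w} else {})"
      using par_props(1)[OF w] by auto
    then show "card {v \<in> V. 2 \<le> depth w \<and> par w = v} = (if 2 \<le> depth w then 1 else 0)" by simp
  qed
  also have "\<dots> = card {v \<in> V. 2 \<le> depth v}" using fin by (simp add: sum.If_cases Int_def)
  finally show ?thesis .
qed

text \<open>The three vertices end the path to \<open>v\<close>, as in
  \<open>chorded_three_ups\<close>. So a chain of parents never meets more than two back vertices in
  a row.\<close>

lemma no_three_backs:
  assumes "v \<in> backs" "par v \<in> backs" "par (par v) \<in> backs"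
  shows False
proof -
  have v: "v \<in> V" "2 \<le> depth v" using assms by (auto simp: backs_def)
  have pv: "par v \<in> V" "2 \<le> depth (par v)" using assms by (auto simp: backs_def)
  obtain c where c: "Suc (Suc c) < depth v" "adj v (P v ! c)" using assms(1) by (elim backE)
  obtain b where b: "Suc (Suc b) < depth (par v)" "adj (par v) (P (par v) ! b)" using assms(2) by (elim backE)
  obtain a where a: "Suc (Suc a) < depth (par (par v))" "adj (par (par v)) (P (par (par v)) ! a)"
    using assms(3) by (elim backE)
  define d where "d = depth v - 3"
  have d: "depth v = d + 3" "depth (par v) = d + 2" "depth (par (par v)) = d + 1"
    using par_props(3)[OF v] par_props(3)[OF pv] pv by (auto simp: d_def)
  have p1: "par v = P v ! (d + 1)" using d by (simp add: par_def)
  have "par (par v) = P (par v) ! d" using d by (simp add: par_def[of "par v"])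
  then have p2: "par (par v) = P v ! d" using nth_nth[OF v(1), of "d + 1" d] d p1 by simp
  have p0: "v = P v ! (d + 2)" using nth_last[OF v(1)] d by simp
  have 1: "adj (P v ! (d + 1)) (P v ! b)" using b nth_nth[OF v(1), of "d + 1" b] d p1 by simp
  have 2: "adj (P v ! d) (P v ! a)" using a nth_nth[OF v(1), of d a] d p2 by simp
  have 3: "adj (P v ! (d + 2)) (P v ! c)" using c p0 by simp
  have "\<exists>X \<subseteq> (!) (P v) ` {..d + 2}. chorded X"
  proof (rule chorded_three_ups[OF _ _ 2 _ 1 _ 3])
    show "inj_on ((!) (P v)) {..d + 2}" by (rule inj_on_subset[OF inj_P[OF v(1)]]) (use d in auto)
    show "\<And>i. i < d + 2 \<Longrightarrow> adj (P v ! i) (P v ! Suc i)" using path_P[OF v(1)] d by simp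
  qed (use a b c d in auto)
  moreover have "(!) (P v) ` {..d + 2} \<subseteq> V" using nth_in[OF v(1)] d by auto
  ultimately show False using chordless by blast
qed

text \<open>Another neighbour \<open>w\<close> below the parent would lie below \<open>v\<close>,
  the only child. Then the parent jumps down past \<open>v\<close> while \<open>v\<close> jumps up
  past its parent, and \<open>chorded_up_down\<close> applies.\<close>

lemma unary_no_down:
  assumes v: "v \<in> backs" and only: "children (par v) = {v}"
  shows "down (par v) = {v}"
proof (rule ccontr)
  let ?p = "par v"
  obtain a where a: "v \<in> V" "Suc (Suc a) < depth v" "adj v (P v ! a)" using backE[OF v] .
  have v2: "2 \<le> depth v" using a by simp
  note p = par_props[OF a(1) v2]
  assume "down ?p \<noteq> {v}"
  moreover have "v \<in> down ?p" using children_down p(4) by blast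
  ultimately obtain w where w: "w \<in> V" "w \<noteq> v" "adj ?p w" "?p \<in> set (P w)"
    by (auto simp: down_def)
  have "?p \<noteq> w" using w adj_irrefl by auto
  note c = child_on_path[OF w(1,4) this]
  then have v_eq: "P w ! depth ?p = v" using only by simp
  define i where "i = depth ?p - 1"
  have i: "depth ?p = Suc i" "depth v = Suc (Suc i)" using p v2 by (auto simp: i_def)
  have wi: "P w ! i = ?p" "P w ! Suc i = v" "Suc i < depth w" using c v_eq i by auto
  have "depth w \<noteq> Suc (Suc i)" using wi nth_last[OF w(1)] w(2) by force
  then have lt: "Suc (Suc i) < depth w" using wi by simp
  have "P v ! a = P w ! a" using nth_nth[OF w(1), of "Suc i" a] wi a i by simp
  have "chorded ((!) (P w) ` {a..depth w - 1})"
  proof (rule chorded_up_down[where i = i])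
    show "inj_on ((!) (P w)) {..depth w - 1}" by (rule inj_on_subset[OF inj_P[OF w(1)]]) (use lt in auto)
    show "\<And>i. i < depth w - 1 \<Longrightarrow> adj (P w ! i) (P w ! Suc i)" using path_P[OF w(1)] by simp
    show "adj (P w ! Suc i) (P w ! a)" using a wi \<open>P v ! a = P w ! a\<close> by simp
    show "adj (P w ! i) (P w ! (depth w - 1))" using w nth_last[OF w(1)] wi by simp
  qed (use a i lt in auto)
  moreover have "(!) (P w) ` {a..depth w - 1} \<subseteq> V" using nth_in[OF w(1)] lt by auto
  ultimately show False using chordless by blast
qed

section \<open>Leaves and inner vertices of degree two\<close>

definition leaves :: "'a set" where "leaves = {v \<in> V. children v = {}}"
definition low_inner :: "'a set" where
  "low_inner = {v \<in> V. 2 \<le> depth v \<and> children v \<noteq> {} \<and> card (nbrs V v) \<le> 2}"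

lemma finite_leaves [simp]: "finite leaves" "finite low_inner"
  using fin by (simp_all add: leaves_def low_inner_def)

lemma leaf_down: "v \<in> leaves \<Longrightarrow> down v = {}"
proof (rule ccontr)
  assume v: "v \<in> leaves" "down v \<noteq> {}"
  then obtain w where w: "w \<in> V" "adj v w" "v \<in> set (P w)" by (auto simp: down_def)
  then have "v \<noteq> w" using adj_irrefl by auto
  then show False using child_on_path(3)[OF w(1,3)] v by (auto simp: leaves_def)
qed

lemma leaf_deg: "v \<in> leaves \<Longrightarrow> card (nbrs V v) = card (up v)"
  using card_nbrs leaf_down by (simp add: leaves_def)

lemma low_inner_nbrs:
  assumes v: "v \<in> low_inner"
  obtains c where "children v = {c}" "nbrs V v = {par v, c}" "v \<notin> backs"
proof -
  have V: "v \<in> V" "2 \<le> depth v" "children v \<noteq> {}" "card (up v) + card (down v) \<le> 2"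
    using v card_nbrs by (auto simp: low_inner_def)
  have "0 < card (children v)" using V(3) by (simp add: card_gt_0_iff)
  moreover have "card (children v) \<le> card (down v)" using children_down by (simp add: card_mono)
  ultimately have c: "card (children v) = 1" "card (down v) = 1" "card (up v) = 1" "v \<notin> backs"
    using V(4) card_up[OF V(1)] V(2) by (auto split: if_splits)
  obtain c where ch: "children v = {c}" using c(1) by (auto simp: card_1_singleton_iff)
  have "down v = {c}" using children_down[of v] c(2) ch by (auto simp: card_1_singleton_iff)
  moreover have "up v = {par v}"
  proof -
    have "par v \<in> up v" using par_props[OF V(1,2)] by (simp add: up_def)
    then show ?thesis using c(3) by (auto simp: card_1_singleton_iff)
  qed
  ultimately have "nbrs V v = {par v, c}" using nbrs_up_down(1)[OF V(1)] by auto
  then show thesis using that ch c(4) by blast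
qed

text \<open>The neighbours of \<open>y\<close> are its parent and its only child, and
  \<open>x\<close>, lying below \<open>y\<close>, is too deep to be the parent.\<close>

lemma low_inner_child:
  assumes "y \<in> low_inner" "x \<in> V" "adj x y" "y \<in> set (P x)"
  shows "children y = {x}"
proof -
  obtain c where c: "children y = {c}" "nbrs V y = {par y, c}" using low_inner_nbrs[OF assms(1)] by metis
  have y: "y \<in> V" "2 \<le> depth y" using assms(1) by (auto simp: low_inner_def)
  have "x \<in> nbrs V y" using assms adj_sym by (simp add: nbrs_def)
  moreover have "x \<noteq> par y"
  proof
    assume "x = par y"
    then have "depth x = depth y - 1" using par_props(3)[OF y] by simp
    moreover have "depth y \<le> depth x" using ancestor_depth[OF assms(2,4)] by (cases "y = x") auto
    ultimately show False using y by simp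
  qed
  ultimately show ?thesis using c by auto
qed

text \<open>The summands added to the degree cover its shortfall from 3: two for a leaf, one for an
  inner vertex of degree 2, two more for a root. A leaf with a back edge lacks only one, which is
  recorded on the left.\<close>

lemma deg_lower_bound:
  assumes v: "v \<in> V"
  shows "3 + of_bool (v \<in> leaves \<inter> backs) \<le> card (nbrs V v) + 2 * of_bool (v \<in> leaves)
    + of_bool (v \<in> low_inner) + 2 * (of_bool (depth v < 2) :: nat)"
proof (cases "v \<in> leaves")
  case True
  then show ?thesis using leaf_deg[OF True] card_up[OF v] by (auto simp: backs_def)
next
  case False
  then have ch: "0 < card (children v)" using v by (simp add: leaves_def card_gt_0_iff)
  have "card (children v) \<le> card (down v)" using children_down by (simp add: card_mono)
  then have d: "card (up v) + 1 \<le> card (nbrs V v)" using ch card_nbrs[OF v] by simp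
  show ?thesis
  proof (cases "2 \<le> depth v")
    case True
    then have "2 \<le> card (nbrs V v)" using d card_up[OF v] by simp
    moreover have "v \<in> low_inner \<longleftrightarrow> card (nbrs V v) \<le> 2"
      using v True ch by (auto simp: low_inner_def)
    ultimately show ?thesis using False by (cases "v \<in> low_inner") simp_all
  next
    case depth: False
    then show ?thesis using False d by simp
  qed
qed

text \<open>Sum \<open>deg_lower_bound\<close> and insert \<open>sum_deg\<close>. The allowance of
  two per root matches the roots missing from \<open>sum_deg\<close>, so the roots cancel.\<close>

lemma card_bound_backs:
  "card V + card (leaves \<inter> backs) \<le> 2 * card leaves + card low_inner + 2 * card backs"
proof -
  have cnt: "(\<Sum>v\<in>V. of_bool (v \<in> A)) = card (A \<inter> V)" for A
    using fin by (simp add: sum.If_cases of_bool_def Int_commute)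
  have sub: "(leaves \<inter> backs) \<inter> V = leaves \<inter> backs" "leaves \<inter> V = leaves" "low_inner \<inter> V = low_inner"
    by (auto simp: leaves_def low_inner_def)
  have "(\<Sum>v\<in>V. 3 + of_bool (v \<in> leaves \<inter> backs)) \<le> (\<Sum>v\<in>V. card (nbrs V v) + 2 * of_bool (v \<in> leaves)
    + of_bool (v \<in> low_inner) + 2 * (of_bool (v \<in> {v. depth v < 2}) :: nat))"
    using deg_lower_bound by (intro sum_mono) simp
  then have "3 * card V + card (leaves \<inter> backs) \<le> (\<Sum>v\<in>V. card (nbrs V v)) + 2 * card leaves
    + card low_inner + 2 * card ({v. depth v < 2} \<inter> V)"
    unfolding sum.distrib sum_distrib_left[symmetric] cnt sub by simp
  moreover have "card V = card {v \<in> V. 2 \<le> depth v} + card ({v. depth v < 2} \<inter> V)"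
    using fin by (subst card_Un_disjoint[symmetric]) (auto intro!: arg_cong[of _ _ card])
  ultimately show ?thesis unfolding sum_deg by simp
qed

section \<open>Counting back vertices\<close>

definition branch_backs :: "'a set" where "branch_backs = {v \<in> backs. 2 \<le> card (children (par v))}"

lemma backs_depth: "v \<in> backs \<Longrightarrow> v \<in> V \<and> 2 \<le> depth v \<and> par v \<in> V \<and> 2 \<le> depth (par v)"
proof -
  assume v: "v \<in> backs"
  obtain j where j: "v \<in> V" "Suc (Suc j) < depth v" using backE[OF v] by blast
  then have "2 \<le> depth v" by simp
  then show ?thesis using j par_props(1,3)[OF j(1)] by simp
qed

text \<open>There are at most \<open>card V\<close> children in all, so the surplus
  \<open>n - 1\<close>, summed over vertices with \<open>n > 0\<close> children, is at most the
  number of leaves; and \<open>n <= 2 * (n - 1)\<close> at a branching.\<close>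

lemma card_branch_backs: "card branch_backs \<le> 2 * card leaves"
proof -
  let ?D = "{p \<in> V. 2 \<le> card (children p)}"
  have "branch_backs \<subseteq> (\<Union>p\<in>?D. children p)"
    using backs_depth par_props(4) by (auto simp: branch_backs_def)
  then have "card branch_backs \<le> card (\<Union>p\<in>?D. children p)"
    using fin by (intro card_mono) auto
  also have "\<dots> \<le> (\<Sum>p\<in>?D. card (children p))" using fin by (intro card_UN_le) auto
  finally have 1: "card branch_backs \<le> (\<Sum>p\<in>?D. card (children p))" .
  have "(\<Sum>p\<in>V. (if 2 \<le> card (children p) then card (children p) else 0) + 2)
    \<le> (\<Sum>p\<in>V. 2 * card (children p) + 2 * of_bool (p \<in> leaves))"
  proof (rule sum_mono)
    fix p assume p: "p \<in> V"
    have "(if 2 \<le> n then n else 0) + 2 \<le> 2 * n + 2 * of_bool (n = 0)" for n :: nat by auto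
    from this[of "card (children p)"] show "(if 2 \<le> card (children p) then card (children p) else 0) + 2
      \<le> 2 * card (children p) + 2 * of_bool (p \<in> leaves)" using p by (simp add: leaves_def)
  qed
  moreover have "(\<Sum>p\<in>V. of_bool (p \<in> leaves)) = card leaves"
    using fin by (simp add: sum.If_cases of_bool_def leaves_def Int_def)
  ultimately have "(\<Sum>p\<in>?D. card (children p)) + 2 * card V \<le> 2 * (\<Sum>p\<in>V. card (children p)) + 2 * card leaves"
    using fin by (simp only: sum.distrib sum_distrib_left[symmetric] sum.inter_filter sum_constant) simp
  moreover have "(\<Sum>p\<in>V. card (children p)) \<le> card V"
    unfolding sum_children using fin by (intro card_mono) auto
  ultimately show ?thesis using 1 by simp
qed

lemma unary_child:
  assumes "v \<in> backs" "v \<notin> branch_backs"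
  shows "children (par v) = {v}"
proof -
  have v: "v \<in> V" "2 \<le> depth v" using assms by (auto simp: backs_def)
  have "card (children (par v)) < 2" using assms by (simp add: branch_backs_def)
  moreover have "v \<in> children (par v)" using par_props(4)[OF v] .
  moreover from this have "0 < card (children (par v))" by (auto simp: card_gt_0_iff)
  ultimately have "card (children (par v)) = 1" by simp
  then show ?thesis using \<open>v \<in> children (par v)\<close> by (auto simp: card_1_singleton_iff)
qed

text \<open>By \<open>unary_no_down\<close> the parent has only \<open>v\<close> below it and,
  having no back edge, only its own parent above it.\<close>

lemma unary_parent:
  assumes v: "v \<in> backs" "v \<notin> branch_backs" "par v \<notin> backs"
  shows "par v \<in> low_inner"
proof -
  note c = unary_child[OF v(1,2)]
  have "card (down (par v)) = 1" using unary_no_down[OF v(1) c] by simp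
  moreover have "card (up (par v)) = 1" using card_up v backs_depth[OF v(1)] by simp
  ultimately show ?thesis using c backs_depth[OF v(1)] card_nbrs[of "par v"] by (auto simp: low_inner_def)
qed

definition low_backs :: "'a set" where "low_backs = {v \<in> backs - branch_backs. par v \<in> low_inner}"

text \<open>A back vertex in neither class is an only child, so \<open>par\<close> is injective on
  such vertices, and its parent is again in \<open>backs\<close>. By \<open>no_three_backs\<close>
  that parent belongs to one of the two classes; having a child, it is not a leaf.\<close>

lemma card_backs:
  "card backs \<le> card branch_backs + card low_backs + card (branch_backs - leaves) + card (low_backs - leaves)"
proof -
  let ?C = "{v \<in> backs - branch_backs. par v \<in> backs}"
  have inj: "inj_on par (backs - branch_backs)"
    using unary_child by (intro inj_onI) (metis DiffE singletonD singletonI)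
  have "par ` ?C \<subseteq> (branch_backs - leaves) \<union> (low_backs - leaves)"
  proof
    fix p assume "p \<in> par ` ?C"
    then obtain v where v: "v \<in> backs" "v \<notin> branch_backs" "p = par v" "p \<in> backs" by auto
    then have "p \<notin> leaves" using unary_child by (auto simp: leaves_def)
    moreover have "p \<in> low_backs" if "p \<notin> branch_backs"
      using unary_parent[OF v(4) that] no_three_backs v that by (auto simp: low_backs_def)
    ultimately show "p \<in> (branch_backs - leaves) \<union> (low_backs - leaves)" by blast
  qed
  then have "card (par ` ?C) \<le> card ((branch_backs - leaves) \<union> (low_backs - leaves))"
    by (intro card_mono) (auto simp: branch_backs_def low_backs_def)
  then have "card ?C \<le> card (branch_backs - leaves) + card (low_backs - leaves)"
    using card_Un_le[of "branch_backs - leaves" "low_backs - leaves"]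
      card_image[OF inj_on_subset[OF inj, of ?C]] by (simp add: subset_iff)
  moreover have "backs = branch_backs \<union> low_backs \<union> ?C"
    using unary_parent by (auto simp: branch_backs_def low_backs_def)
  then have "card backs \<le> card branch_backs + card low_backs + card ?C"
    using card_Un_le[of "branch_backs \<union> low_backs" ?C] card_Un_le[of branch_backs low_backs] by simp
  ultimately show ?thesis by simp
qed

text \<open>One of the two is an ancestor of the other, so it is no leaf, and an inner vertex of
  degree 2 has only its child as a neighbour below.\<close>

lemma adj_low_cases:
  assumes "x \<in> leaves \<union> low_inner" "y \<in> leaves \<union> low_inner" "adj x y"
  shows "(y \<in> low_inner \<and> children y = {x}) \<or> (x \<in> low_inner \<and> children x = {y})"
proof -
  have V: "x \<in> V" "y \<in> V" using assms by (auto simp: leaves_def low_inner_def)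
  have no_leaf: "z \<notin> leaves" if "w \<in> V" "z \<in> set (P w)" "adj w z" for w z
    using leaf_down[of z] that adj_sym unfolding down_def by blast
  from normal[OF V assms(3)] show ?thesis
  proof
    assume "x \<in> set (P y)"
    then show ?thesis using low_inner_child[of x y] no_leaf[of y x] V assms adj_sym by blast
  next
    assume "y \<in> set (P x)"
    then show ?thesis using low_inner_child[of y x] no_leaf[of x y] V assms by blast
  qed
qed

text \<open>Every vertex beyond the leaves is paid for by leaves and low vertices: a back vertex is a child
  of a branching vertex, the child of a low vertex, or the only child of a back vertex of one of the
  first two kinds.\<close>

theorem card_le_low_indep:
  assumes a: "\<And>I. I \<subseteq> V \<Longrightarrow> \<forall>v\<in>I. card (nbrs V v) \<le> 2 \<Longrightarrow> indep I \<Longrightarrow> card I \<le> a"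
  shows "card V \<le> 12 * a"
proof -
  have low: "\<forall>v\<in>leaves \<union> low_inner. card (nbrs V v) \<le> 2" "leaves \<union> low_inner \<subseteq> V"
    using leaf_deg card_up by (auto simp: low_inner_def leaves_def)
  have disj: "leaves \<inter> low_inner = {}" by (auto simp: leaves_def low_inner_def)
  \<comment> \<open>Adjacent vertices of these kinds are parent and child, so the parity of the
    depth separates them into two independent sets.\<close>
  let ?E = "{v \<in> leaves \<union> low_inner. even (depth v)}" and ?O = "{v \<in> leaves \<union> low_inner. odd (depth v)}"
  have par: "even (depth x) \<noteq> even (depth y)"
    if xy: "x \<in> leaves \<union> low_inner" "y \<in> leaves \<union> low_inner" "adj x y" for x y
  proof -
    have "depth c = Suc (depth p)" if "children p = {c}" "p \<in> V" for c p
    proof -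
      have "c \<in> children p" using that by simp
      then have c: "c \<in> V" "2 \<le> depth c" "par c = p" by (auto simp: children_def)
      then show ?thesis using par_props(3)[OF c(1,2)] by simp
    qed
    then show ?thesis using adj_low_cases[OF xy] low(2) xy by auto
  qed
  then have "indep ?E" "indep ?O" unfolding indep_def by blast+
  then have "card ?E \<le> a" "card ?O \<le> a" using low by (auto intro!: a)
  moreover have "card (leaves \<union> low_inner) = card ?E + card ?O"
    by (subst card_Un_disjoint[symmetric]) (auto intro!: arg_cong[of _ _ card])
  moreover have "card (leaves \<union> low_inner) = card leaves + card low_inner"
    using disj by (simp add: card_Un_disjoint)
  ultimately have 1: "card leaves + card low_inner \<le> 2 * a" by simp
  let ?S = "par ` (low_backs - leaves)"
  have S: "?S \<subseteq> low_inner" by (auto simp: low_backs_def)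
  have "indep (leaves \<union> ?S)"
  proof -
    \<comment> \<open>The only child of \<open>par v\<close> is \<open>v\<close>. As a non-leaf of
      this set it would be in \<open>low_inner\<close>, whose vertices carry no back edge.\<close>
    have no: "False" if "x \<in> leaves \<union> ?S" "y \<in> ?S" "children y = {x}" for x y
    proof -
      obtain v where v: "v \<in> low_backs" "v \<notin> leaves" "y = par v" using \<open>y \<in> ?S\<close> by auto
      then have "x = v" using unary_child[of v] that(3) by (auto simp: low_backs_def)
      then have "v \<in> low_inner" using that(1) v S by auto
      then have "v \<notin> backs" using low_inner_nbrs[of v] by blast
      then show False using v(1) by (simp add: low_backs_def)
    qed
    have *: "\<not> (y \<in> low_inner \<and> children y = {x})"
      if xy: "x \<in> leaves \<union> ?S" "y \<in> leaves \<union> ?S" for x y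
    proof
      assume y: "y \<in> low_inner \<and> children y = {x}"
      then have "y \<in> ?S" using xy(2) disj by auto
      then show False using y no[OF xy(1)] by blast
    qed
    show ?thesis unfolding indep_def
    proof (intro ballI notI)
      fix x y assume xy: "x \<in> leaves \<union> ?S" "y \<in> leaves \<union> ?S" "adj x y"
      then have "x \<in> leaves \<union> low_inner" "y \<in> leaves \<union> low_inner" using S by auto
      from adj_low_cases[OF this xy(3)] show False using *[OF xy(1,2)] *[OF xy(2,1)] by blast
    qed
  qed
  then have "card (leaves \<union> ?S) \<le> a" using low S by (intro a) auto
  moreover have "card (leaves \<union> ?S) = card leaves + card ?S"
    using S disj finite_subset[OF S] by (intro card_Un_disjoint) auto
  moreover have "card ?S = card (low_backs - leaves)"
  proof (rule card_image, rule inj_onI)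
    fix v w assume "v \<in> low_backs - leaves" "w \<in> low_backs - leaves" "par v = par w"
    moreover have "children (par x) = {x}" if "x \<in> low_backs - leaves" for x
      using that unary_child[of x] by (simp add: low_backs_def)
    ultimately have "{v} = {w}" by metis
    then show "v = w" by simp
  qed
  ultimately have 2: "card leaves + card (low_backs - leaves) \<le> a" by simp
  have fb: "finite branch_backs" "finite low_backs" by (auto simp: branch_backs_def low_backs_def)
  have 3: "card branch_backs = card (branch_backs - leaves) + card (branch_backs \<inter> leaves)"
    "card low_backs = card (low_backs - leaves) + card (low_backs \<inter> leaves)"
    using card_Int_Diff[OF fb(1), of leaves] card_Int_Diff[OF fb(2), of leaves] by simp_all
  have "card (branch_backs \<inter> leaves) + card (low_backs \<inter> leaves)
      = card ((branch_backs \<inter> leaves) \<union> (low_backs \<inter> leaves))"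
    using fb by (intro card_Un_disjoint[symmetric]) (auto simp: low_backs_def)
  also have "\<dots> \<le> card (leaves \<inter> backs)"
    by (intro card_mono) (auto simp: branch_backs_def low_backs_def)
  finally have 4: "card (branch_backs \<inter> leaves) + card (low_backs \<inter> leaves) \<le> card (leaves \<inter> backs)" .
  have 5: "card (low_backs \<inter> leaves) \<le> card leaves" by (intro card_mono) auto
  \<comment> \<open>Altogether \<open>card V\<close> is at most \<open>11 * card leaves + card
    low_inner + 4 * card (low_backs - leaves)\<close>, which by 1 and 2 is at most
    \<open>2 * a + 4 * a + 6 * a\<close>. The term \<open>card (leaves \<inter> backs)\<close>
    brings the first coefficient down from 12 to 11.\<close>
  show ?thesis using 1 2 3 4 5 card_bound_backs card_backs card_branch_backs by linarith
qed

end

theorem (in simple_graph) ex_chorded: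
  assumes "finite V"
    and "\<And>I. I \<subseteq> V \<Longrightarrow> \<forall>v\<in>I. card (nbrs V v) \<le> 2 \<Longrightarrow> indep I \<Longrightarrow> card I \<le> a"
    and "12 * a < card V"
  shows "\<exists>X\<subseteq>V. chorded X"
proof (rule ccontr)
  assume c: "\<not> ?thesis"
  obtain P where P: "forest V P"
    "\<And>u v. u \<in> V \<Longrightarrow> v \<in> V \<Longrightarrow> adj u v \<Longrightarrow> u \<in> set (P v) \<or> v \<in> set (P u)"
    using ex_normal_forest[OF assms(1)] by metis
  interpret chordless_forest adj V P
    using assms(1) P c by unfold_locales auto
  show False using card_le_low_indep[OF assms(2)] assms(3) by simp
qed

section \<open>Sets grown from chorded 4-cycles\<close>

text \<open>The graph on \<open>{a, b, c, d}\<close> misses at most one edge.\<close>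

definition near_clique4 :: "('a \<Rightarrow> 'a \<Rightarrow> bool) \<Rightarrow> 'a \<Rightarrow> 'a \<Rightarrow> 'a \<Rightarrow> 'a \<Rightarrow> bool" where
  "near_clique4 e a b c d \<longleftrightarrow>
     e a c \<and> e a d \<and> e b c \<and> e b d \<and> e c d \<or> e a b \<and> e a d \<and> e b c \<and> e b d \<and> e c d \<or>
     e a b \<and> e a c \<and> e b c \<and> e b d \<and> e c d \<or> e a b \<and> e a c \<and> e a d \<and> e b d \<and> e c d \<or>
     e a b \<and> e a c \<and> e a d \<and> e b c \<and> e c d \<or> e a b \<and> e a c \<and> e a d \<and> e b c \<and> e b d"

text \<open>Six of the 35 partitions of an 8-set into two 4-sets suffice.\<close>

lemma near_clique4_split:
  fixes e :: "nat \<Rightarrow> nat \<Rightarrow> bool"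
  assumes "e 0 1 \<and> e 0 2 \<and> e 0 3 \<and> e 1 2 \<and> e 1 3" "\<forall>i<4. e i 4" "\<forall>i<5. \<forall>j<i. e i 5 \<or> e j 5"
    "\<forall>i<6. \<forall>j<i. \<forall>k<j. e i 6 \<or> e j 6 \<or> e k 6"
    "\<forall>i<7. \<forall>j<i. \<forall>k<j. \<forall>l<k. e i 7 \<or> e j 7 \<or> e k 7 \<or> e l 7"
  shows "(near_clique4 e 0 1 2 7 \<and> near_clique4 e 3 4 5 6) \<or>
    (near_clique4 e 0 2 5 6 \<and> near_clique4 e 1 3 4 7) \<or> (near_clique4 e 0 1 2 5 \<and> near_clique4 e 3 4 6 7) \<or>
    (near_clique4 e 0 2 6 7 \<and> near_clique4 e 1 3 4 5) \<or> (near_clique4 e 0 1 2 6 \<and> near_clique4 e 3 4 5 7) \<or>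
    (near_clique4 e 0 2 5 7 \<and> near_clique4 e 1 3 4 6)"
  using assms unfolding near_clique4_def
  by (simp only: eval_nat_numeral All_less_Suc not_less0 simp_thms BitM.simps One_nat_def) sat

context simple_graph begin

lemma chorded_near_clique4:
  assumes "distinct [a, b, c, d]" "near_clique4 adj a b c d"
  shows "chorded {a, b, c, d}"
proof -
  have *: "chorded X" if "distinct [p, q, r, s]" "adj p q" "adj q r" "adj r s" "adj p s" "adj p r" "X = {p, q, r, s}"
    for p q r s X
  proof -
    have "adj s p" using that(5) by (rule adj_sym)
    then show ?thesis using that by (intro chordedI[where u = p and as = "[q]" and v = r and bs = "[s]"]) auto
  qed
  note sy = adj_sym[of a b] adj_sym[of a c] adj_sym[of a d] adj_sym[of b c] adj_sym[of b d] adj_sym[of c d]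
  have d: "distinct [a, c, b, d]" "distinct [a, b, c, d]" "distinct [a, b, d, c]" "distinct [b, a, c, d]"
    "distinct [b, a, d, c]" "distinct [c, a, d, b]" using assms(1) by auto
  from assms(2) show ?thesis unfolding near_clique4_def
    by (elim disjE conjE)
      (use d sy in \<open>blast intro: *[OF d(1)] *[OF d(2)] *[OF d(3)] *[OF d(4)] *[OF d(5)] *[OF d(6)]\<close>)+
qed

lemma chorded4E:
  assumes "chorded X" "card X = 4"
  obtains a b c d where "distinct [a, b, c, d]" "X = {a, b, c, d}"
    "adj a b" "adj a c" "adj a d" "adj b c" "adj b d"
proof -
  obtain u as v bs where *: "X = set (u # as @ v # bs)" "distinct (u # as @ v # bs)"
    "successively adj (u # as @ v # bs)" "adj (last bs) u" "adj u v" "as \<noteq> []" "bs \<noteq> []"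
    using assms(1) unfolding chorded_def by blast
  have "length (u # as @ v # bs) = 4" using assms(2) distinct_card[OF *(2)] *(1) by simp
  then have "length as + length bs = 2" by simp
  moreover have "0 < length as" "0 < length bs" using * by auto
  ultimately have "length as = 1" "length bs = 1" by linarith+
  then obtain x y where xy: "as = [x]" "bs = [y]" by (auto simp: length_Suc_conv)
  show thesis by (rule that[of u v x y]) (use * xy adj_sym[of y u] adj_sym[of x v] in auto)
qed

text \<open>The induction provides an order of insertion in which each new vertex has four
  neighbours among the earlier ones; \<open>grown_SucE\<close> recovers it.\<close>

inductive grown :: "'a set \<Rightarrow> bool" where
  base: "chorded X \<Longrightarrow> card X = 4 \<Longrightarrow> grown X"
| step: "grown Q \<Longrightarrow> v \<notin> Q \<Longrightarrow> 4 \<le> card (nbrs Q v) \<Longrightarrow> grown (insert v Q)"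

lemma grown_finite: "grown Q \<Longrightarrow> finite Q \<and> 4 \<le> card Q"
  by (induction rule: grown.induct) (auto intro: card_ge_0_finite)

lemma grown_SucE:
  assumes "grown Q" "card Q = Suc n" "4 \<le> n"
  obtains v Q' where "Q = insert v Q'" "v \<notin> Q'" "4 \<le> card (nbrs Q' v)" "grown Q'" "card Q' = n"
  using assms(1)
proof cases
  case base
  then show ?thesis using assms by simp
next
  case (step Q v)
  then show ?thesis using that assms(2) grown_finite[of Q] by auto
qed

lemma grown_chorded4: "grown Q \<Longrightarrow> \<exists>X\<subseteq>Q. chorded X \<and> card X = 4"
  by (induction rule: grown.induct) blast+

text \<open>\<open>v\<close> has at most \<open>card Q - 4\<close> non-neighbours in
  \<open>Q\<close>, fewer than \<open>S\<close> has elements.\<close>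

lemma many_nbrs:
  assumes "finite Q" "4 \<le> card (nbrs Q v)" "S \<subseteq> Q" "card Q < card S + 4"
  shows "\<exists>x\<in>S. adj x v"
proof (rule ccontr)
  assume "\<not> ?thesis"
  then have "nbrs Q v \<subseteq> Q - S" using adj_sym unfolding nbrs_def by blast
  then have "card (nbrs Q v) \<le> card Q - card S"
    using assms by (metis card_Diff_subset card_mono finite_Diff finite_subset)
  then show False using assms card_mono[OF assms(1,3)] by linarith
qed

text \<open>Number the vertices in order of insertion, with \<open>0\<close> and \<open>1\<close>
  the ends of the chord of the initial 4-set. Vertex \<open>n >= 4\<close> then misses at most
  \<open>n - 4\<close> earlier ones, which is what \<open>near_clique4_split\<close>
  assumes.\<close>

lemma grown8_split:
  assumes "grown Q" "card Q = 8"
  shows "\<exists>X Y. X \<subseteq> Q \<and> Y \<subseteq> Q \<and> X \<inter> Y = {} \<and> chorded X \<and> chorded Y \<and> card X = 4 \<and> card Y = 4"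
proof -
  obtain v7 Q7 where 7: "Q = insert v7 Q7" "v7 \<notin> Q7" "4 \<le> card (nbrs Q7 v7)" "grown Q7" "card Q7 = 7"
    using grown_SucE[OF assms(1), of 7] assms(2) by auto
  obtain v6 Q6 where 6: "Q7 = insert v6 Q6" "v6 \<notin> Q6" "4 \<le> card (nbrs Q6 v6)" "grown Q6" "card Q6 = 6"
    using grown_SucE[OF 7(4), of 6] 7(5) by auto
  obtain v5 Q5 where 5: "Q6 = insert v5 Q5" "v5 \<notin> Q5" "4 \<le> card (nbrs Q5 v5)" "grown Q5" "card Q5 = 5"
    using grown_SucE[OF 6(4), of 5] 6(5) by auto
  obtain v4 Q4 where 4: "Q5 = insert v4 Q4" "v4 \<notin> Q4" "4 \<le> card (nbrs Q4 v4)" "grown Q4" "card Q4 = 4"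
    using grown_SucE[OF 5(4), of 4] 5(5) by auto
  have "chorded Q4" using 4(4)
  proof cases
    case (step Q v)
    then show ?thesis using grown_finite[of Q] 4(5) by auto
  qed
  then obtain a b c d where abcd: "distinct [a, b, c, d]" "Q4 = {a, b, c, d}"
    "adj a b" "adj a c" "adj a d" "adj b c" "adj b d"
    using chorded4E 4(5) by metis
  define v where "v = (!) [a, b, c, d, v4, v5, v6, v7]"
  have v_simps: "v 0 = a" "v 1 = b" "v 2 = c" "v 3 = d" "v 4 = v4" "v 5 = v5" "v 6 = v6" "v 7 = v7"
    by (simp_all add: v_def)
  have dist: "distinct [a, b, c, d, v4, v5, v6, v7]" using abcd(1,2) 4 5 6 7 by auto
  have inj: "inj_on v {..<8}" unfolding v_def by (rule inj_on_nth[OF dist]) auto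
  have Q: "v ` {..<4} = Q4" "v ` {..<5} = Q5" "v ` {..<6} = Q6" "v ` {..<7} = Q7" "v ` {..<8} = Q"
    unfolding 7(1) 6(1) 5(1) 4(1) abcd(2)
    by (auto simp: v_simps eval_nat_numeral lessThan_Suc v_def)
  have many: "\<exists>i\<in>I. adj (v i) w"
    if "4 \<le> card (nbrs (v ` {..<n}) w)" "I \<subseteq> {..<n}" "n < card I + 4" "n \<le> 8" for n I w
  proof -
    have inj': "inj_on v {..<n}" by (rule inj_on_subset[OF inj]) (use that in auto)
    have "card (v ` {..<n}) = n" "card (v ` I) = card I"
      using card_image[OF inj'] card_image[OF inj_on_subset[OF inj' that(2)]] by simp_all
    then show ?thesis using many_nbrs[of "v ` {..<n}" w "v ` I"] that by auto
  qed
  let ?e = "\<lambda>i j. adj (v i) (v j)"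
  have e4: "\<forall>i<4. ?e i 4" using many[of 4 v4 "{i}" for i] 4(3) by (auto simp: Q v_simps(5))
  have e5: "\<forall>i<5. \<forall>j<i. ?e i 5 \<or> ?e j 5"
    using many[of 5 v5 "{i, j}" for i j] 5(3) by (auto simp: Q v_simps(6) card_insert_if)
  have e6: "\<forall>i<6. \<forall>j<i. \<forall>k<j. ?e i 6 \<or> ?e j 6 \<or> ?e k 6"
    using many[of 6 v6 "{i, j, k}" for i j k] 6(3) by (auto simp: Q v_simps(7) card_insert_if)
  have e7: "\<forall>i<7. \<forall>j<i. \<forall>k<j. \<forall>l<k. ?e i 7 \<or> ?e j 7 \<or> ?e k 7 \<or> ?e l 7"
    using many[of 7 v7 "{i, j, k, l}" for i j k l] 7(3) by (auto simp: Q v_simps(8) card_insert_if)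
  have e0: "?e 0 1 \<and> ?e 0 2 \<and> ?e 0 3 \<and> ?e 1 2 \<and> ?e 1 3" using abcd by (simp add: v_def)
  note split = near_clique4_split[of ?e, OF e0 e4 e5 e6 e7]
  have pair: ?thesis
    if *: "near_clique4 ?e i j k l" "near_clique4 ?e i' j' k' l'"
      "distinct [i, j, k, l, i', j', k', l']" "set [i, j, k, l, i', j', k', l'] \<subseteq> {..<8}"
    for i j k l i' j' k' l'
  proof -
    have d: "distinct (map v [i, j, k, l, i', j', k', l'])"
      using distinct_map_inj_on[OF inj *(3,4)] .
    let ?X = "{v i, v j, v k, v l}" and ?Y = "{v i', v j', v k', v l'}"
    have "?X \<subseteq> Q" "?Y \<subseteq> Q" using *(4) Q(5) by auto
    moreover have "chorded ?X" "chorded ?Y"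
      using *(1,2) d by (auto intro!: chorded_near_clique4 simp: near_clique4_def)
    moreover have "card ?X = 4" "card ?Y = 4" "?X \<inter> ?Y = {}" using d by auto
    ultimately show ?thesis by blast
  qed
  from split show ?thesis
    by (elim disjE conjE) (erule (1) pair, simp, simp)+
qed

text \<open>Sets grow by single vertices and so pass through size 8, where
  \<open>grown8_split\<close> applies.\<close>

lemma grown_split:
  assumes "grown Q" "8 \<le> card Q"
  shows "\<exists>X Y. X \<subseteq> Q \<and> Y \<subseteq> Q \<and> X \<inter> Y = {} \<and> chorded X \<and> chorded Y \<and> card X = 4 \<and> card Y = 4"
  using assms
proof (induction rule: grown.induct)
  case (step Q v)
  show ?case
  proof (cases "8 \<le> card Q")
    case True
    then obtain X Y where "X \<subseteq> Q" "Y \<subseteq> Q" "X \<inter> Y = {}" "chorded X" "chorded Y" "card X = 4" "card Y = 4"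
      using step.IH by blast
    then show ?thesis by (intro exI[of _ X] exI[of _ Y]) auto
  next
    case False
    moreover have "card (insert v Q) = Suc (card Q)"
      using step.hyps(2) grown_finite[OF step.hyps(1)] by simp
    ultimately have "card (insert v Q) = 8" using step.prems by simp
    then show ?thesis by (rule grown8_split[OF grown.step[OF step.hyps]])
  qed
qed (simp add: card_eq_0_iff)

end

section \<open>Shortest chorded cycles\<close>

text \<open>The cycle is \<open>f 0, f 1, \<dots>\<close>, with indices read modulo \<open>l\<close>, so that its rotations are windows
  of the same function.\<close>

locale shortest_chorded = simple_graph adj for adj :: "'a \<Rightarrow> 'a \<Rightarrow> bool" +
  fixes V :: "'a set" and f :: "nat \<Rightarrow> 'a" and l m :: nat
  assumes cycle: "adj (f i) (f (Suc i))" and periodic: "f (i + l) = f i"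
    and inj: "inj_on f {a..<a + l}" and in_V: "f i \<in> V"
    and chord_0: "adj (f 0) (f m)" "2 \<le> m" "m + 2 \<le> l"
    and shortest: "X \<subseteq> V \<Longrightarrow> chorded X \<Longrightarrow> l \<le> card X"
begin

lemma inj_window: "c < a + l \<Longrightarrow> inj_on f {a..c}"
  by (rule inj_on_subset[OF inj[of a]]) auto

lemma window_size:
  assumes "b < a + l" "chorded (f ` I)" "I \<subseteq> {a..b}"
  shows "l \<le> card I"
proof -
  have "inj_on f I" by (rule inj_on_subset[OF inj[of a]]) (use assms in auto)
  then show ?thesis using shortest[OF _ assms(2)] in_V by (simp add: card_image image_subset_iff)
qed

text \<open>The edge from \<open>f a\<close> to \<open>f c\<close> closes the window from
  \<open>a\<close> to \<open>c\<close> into a cycle with another chord, which cannot be shorter than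
  \<open>l\<close>. Windows running past \<open>l\<close> cover the arcs through
  \<open>f 0\<close>.\<close>

lemma no_short_chord:
  assumes "adj (f a) (f c)" "adj (f i) (f j)" "a \<le> i" "Suc i < j" "j \<le> c" "\<not> (i = a \<and> j = c)"
  shows "l \<le> Suc (c - a)"
proof (cases "c < a + l")
  case True
  have "chorded (f ` {a..c})"
    by (rule chorded_cycle_chord[where i = i and j = j])
      (use assms True cycle inj_window in auto)
  then show ?thesis using window_size[of c a "{a..c}"] True assms by simp
qed simp

lemma outside_fan:
  assumes w: "w \<in> V" "w \<notin> range f" "adj w (f a)" "adj w (f b)" "adj w (f c)" and abc: "a < b" "b < c" "c < a + l"
  shows "l \<le> c - a + 2"
proof -
  have "chorded (insert w (f ` {a..c}))"
    by (rule chorded_fan[where b = b])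
      (use assms cycle inj_window[OF abc(3)] in auto)
  then have "l \<le> card (insert w (f ` {a..c}))" using in_V w by (intro shortest) auto
  also have "\<dots> \<le> Suc (card (f ` {a..c}))" by (rule card_insert_le_m1) auto
  also have "\<dots> \<le> Suc (card {a..c})" by (intro Suc_le_mono[THEN iffD2] card_image_le) simp
  finally show ?thesis using abc by simp
qed

lemma cycle_image: "f ` {..<l} = range f"
proof
  show "range f \<subseteq> f ` {..<l}"
  proof
    fix x assume "x \<in> range f"
    then obtain i where "x = f i" by auto
    moreover have "f i = f (i mod l)" for i
    proof (induction i rule: less_induct)
      case (less i)
      show ?case
      proof (cases "i < l")
        case False
        then show ?thesis using less.IH[of "i - l"] periodic[of "i - l"] chord_0 by (simp add: le_mod_geq)
      qed simp
    qed
    ultimately show "x \<in> f ` {..<l}" using chord_0 by (intro image_eqI[of _ _ "i mod l"]) auto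
  qed
qed auto

lemma inj_l: "inj_on f {..<l}"
  using inj[of 0] by (simp add: atLeast0LessThan)

lemma card_cycle: "card (range f) = l"
  using card_image[OF inj_l] cycle_image by simp

lemma sorted_positions:
  assumes "n \<le> card (nbrs (range f) w)"
  shows "\<exists>p. (\<forall>j<n. \<forall>i<j. p i < p j) \<and> (\<forall>i<n. p i < l \<and> adj w (f (p i)))"
proof -
  let ?I = "{i. i < l \<and> adj w (f i)}"
  have "nbrs (range f) w = f ` ?I" unfolding cycle_image[symmetric] by (auto simp: nbrs_def)
  then have card: "n \<le> card ?I" using assms card_image_le[of ?I f] by simp
  let ?p = "(!) (sorted_list_of_set ?I)"
  have len: "length (sorted_list_of_set ?I) = card ?I" by simp
  show ?thesis
  proof (rule exI[of _ ?p], intro conjI allI impI)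
    fix i j assume ij: "i < j" "j < n"
    show "?p i < ?p j"
      using sorted_wrt_nth_less[OF strict_sorted_list_of_set[of ?I] ij(1)] ij card len by simp
  next
    fix i assume "i < n"
    then have "?p i \<in> set (sorted_list_of_set ?I)" using card len by (intro nth_mem) simp
    then show "?p i < l" "adj w (f (?p i))" by simp_all
  qed
qed

text \<open>The windows from \<open>p 0\<close> to \<open>p 2\<close> and from \<open>p 2\<close> to
  \<open>p 0 + l\<close> carry three neighbours each and go round the cycle once, so the two fans
  give \<open>2 * l <= l + 4\<close>.\<close>

lemma outside_nbrs_le_3:
  assumes "5 \<le> l" "w \<in> V" "w \<notin> range f"
  shows "card (nbrs (range f) w) \<le> 3"
proof (rule ccontr)
  assume "\<not> ?thesis"
  then have "4 \<le> card (nbrs (range f) w)" by simp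
  from sorted_positions[OF this] obtain p where
    p: "\<forall>j<4::nat. \<forall>i<j. p i < p j" "\<forall>i<4::nat. p i < l \<and> adj w (f (p i))" by blast
  have lt: "p 0 < p 1" "p 1 < p 2" "p 2 < p 3" "p 3 < l" 
    using p(1)[rule_format, of 1 0] p(1)[rule_format, of 2 1] p(1)[rule_format, of 3 2] p(2) by simp_all
  have a: "adj w (f (p 0))" "adj w (f (p 1))" "adj w (f (p 2))" "adj w (f (p 3))" "adj w (f (p 0 + l))"
    using p(2) periodic by simp_all
  have "l \<le> p 2 - p 0 + 2"
    by (rule outside_fan[OF assms(2,3), of _ "p 1"]) (use a lt in simp_all)
  moreover have "l \<le> p 0 + l - p 2 + 2"
    by (rule outside_fan[OF assms(2,3), of _ "p 3"]) (use a lt in simp_all)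
  ultimately show False using lt assms(1) by linarith
qed

text \<open>Each of three windows omits one of the gaps between cyclically consecutive neighbours.
  Their lengths add up to \<open>2 * l\<close>, so \<open>3 * l <= 2 * l + 6\<close>.\<close>

lemma outside_nbrs_le_2:
  assumes "7 \<le> l" "w \<in> V" "w \<notin> range f"
  shows "card (nbrs (range f) w) \<le> 2"
proof (rule ccontr)
  assume "\<not> ?thesis"
  then have "3 \<le> card (nbrs (range f) w)" by simp
  from sorted_positions[OF this] obtain p where
    p: "\<forall>j<3::nat. \<forall>i<j. p i < p j" "\<forall>i<3::nat. p i < l \<and> adj w (f (p i))" by blast
  have lt: "p 0 < p 1" "p 1 < p 2" "p 2 < l" 
    using p(1)[rule_format, of 1 0] p(1)[rule_format, of 2 1] p(2) by simp_all
  have a: "adj w (f (p 0))" "adj w (f (p 1))" "adj w (f (p 2))" "adj w (f (p 0 + l))" "adj w (f (p 1 + l))"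
    using p(2) periodic by simp_all
  have "l \<le> p 2 - p 0 + 2"
    by (rule outside_fan[OF assms(2,3), of _ "p 1"]) (use a lt in simp_all)
  moreover have "l \<le> p 0 + l - p 1 + 2"
    by (rule outside_fan[OF assms(2,3), of _ "p 2"]) (use a lt in simp_all)
  moreover have "l \<le> p 1 + l - p 2 + 2"
    by (rule outside_fan[OF assms(2,3), of _ "p 0 + l"]) (use a lt in simp_all)
  ultimately show False using lt assms(1) by linarith
qed

text \<open>Three pairwise crossing chords; the cycle uses the first and the third one and has the
  second one as a chord.\<close>

lemma crossing_size:
  assumes chords: "adj (f i) (f j)" "adj (f i') (f j')" "adj (f k) (f e)"
    and ord: "i < i'" "i' < k" "k < j" "j < j'" "j' < e" "e < i + l"
  shows "l \<le> (k - i) + (e - j) + 2"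
proof -
  \<comment> \<open>From \<open>f i'\<close> down to \<open>f i\<close>, across to
    \<open>f j\<close>, up through \<open>f j'\<close> to \<open>f e\<close>, across to
    \<open>f k\<close>, down to \<open>f i'\<close>. The gap from \<open>k\<close> to
    \<open>j\<close> and the one from \<open>e\<close> to \<open>i + l\<close> are avoided.\<close>
  let ?as = "rev (map f [i..<i']) @ map f [j..<j']"
  let ?bs = "map f [Suc j'..<Suc e] @ rev (map f [Suc i'..<Suc k])"
  have "chorded (f ` ({i..k} \<union> {j..e}))"
  proof (rule chordedI)
    show "?as \<noteq> []" "?bs \<noteq> []" using ord by auto
    have "distinct (map f (i' # (rev [i..<i'] @ [j..<j']) @ j' # [Suc j'..<Suc e] @ rev [Suc i'..<Suc k]))"
      by (rule distinct_map_inj_on[OF inj[of i]]) (use ord in \<open>auto simp del: upt_Suc\<close>)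
    then show "distinct (f i' # ?as @ f j' # ?bs)" by (simp add: rev_map del: upt_Suc)
    have "{i..k} \<union> {j..e} = insert i' (insert j' ({i..<i'} \<union> {j..<j'} \<union> {Suc j'..<Suc e} \<union> {Suc i'..<Suc k}))"
      using ord by auto
    then show "f ` ({i..k} \<union> {j..e}) = insert (f i') (insert (f j') (set ?as \<union> set ?bs))"
      by (simp only: image_insert image_Un set_append set_rev set_map set_upt) blast
    have seg: "successively adj (map f [a..<b])" "successively adj (rev (map f [a..<b]))" for a b
      by (intro successively_segment successively_rev_segment cycle)+
    show "successively adj ?as"
      unfolding successively_append_iff using seg ord chords by (auto simp: last_rev hd_map)
    show "successively adj ?bs"
      unfolding successively_append_iff using seg ord adj_sym[OF chords(3)]
      by (simp add: hd_rev last_map del: upt_Suc)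
    show "adj (f i') (hd ?as)" using adj_sym[OF cycle[of "i' - 1"]] ord
      by (simp add: hd_append hd_rev last_map)
    show "adj (last ?as) (f j')" using cycle[of "j' - 1"] ord by (simp add: last_map)
    show "adj (f j') (hd ?bs)" using cycle[of j'] ord by (simp add: hd_append hd_map del: upt_Suc)
    show "adj (last ?bs) (f i')" using adj_sym[OF cycle[of i']] ord
      by (simp add: last_rev hd_map del: upt_Suc)
    show "adj (f i') (f j')" by fact
  qed
  moreover have "{i..k} \<union> {j..e} \<subseteq> {i..e}" using ord by auto
  ultimately have "l \<le> card ({i..k} \<union> {j..e})" using ord(6) by (intro window_size)
  also have "\<dots> \<le> card {i..k} + card {j..e}" by (rule card_Un_le)
  finally show ?thesis using ord by simp
qed

section \<open>Chords of a shortest chorded cycle\<close>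

definition chord_at :: "nat \<Rightarrow> nat \<Rightarrow> bool" where
  "chord_at i j \<longleftrightarrow> adj (f i) (f j) \<and> Suc i < j \<and> j < l \<and> \<not> (i = 0 \<and> j = l - 1)"

text \<open>If the two chords do not cross, one of them closes a window that contains the other and
  is shorter than the cycle.\<close>

lemma chord_at_crosses:
  assumes "chord_at i j" "(i, j) \<noteq> (0, m)"
  shows "0 < i \<and> i < m \<and> m < j"
proof (rule ccontr)
  assume n: "\<not> ?thesis"
  have c: "adj (f i) (f j)" "Suc i < j" "j < l" "\<not> (i = 0 \<and> j = l - 1)"
    using assms(1) by (auto simp: chord_at_def)
  have 0: "f l = f 0" using periodic[of 0] by simp
  consider "j \<le> m" | "m \<le> i" | "i = 0" "m < j" using n by linarith
  then show False
  proof cases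
    case 1
    then show False using no_short_chord[OF chord_0(1) c(1)] c chord_0 assms(2) by force
  next
    case 2
    have "adj (f m) (f l)" using 0 chord_0 adj_sym by simp
    from no_short_chord[OF this c(1)] show False using 2 c chord_0 by simp
  next
    case 3
    from no_short_chord[OF c(1) chord_0(1)] show False using 3 c chord_0 by simp
  qed
qed

text \<open>Nested chords and chords sharing an end contradict \<open>no_short_chord\<close>.
  Otherwise these two and the chord from \<open>0\<close> to \<open>m\<close> cross pairwise, and
  their ends cut the cycle into six gaps. Each of three applications of \<open>crossing_size\<close>
  omits two opposite gaps, so \<open>3 * l <= 2 * l + 6\<close>.\<close>

lemma chord_at_unique:
  assumes l: "7 \<le> l" and c: "chord_at i j" "(i, j) \<noteq> (0, m)" "chord_at i' j'" "(i', j') \<noteq> (0, m)"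
  shows "(i, j) = (i', j')"
proof -
  have *: False if c: "chord_at i j" "0 < i" "i < m" "m < j" "chord_at i' j'" "i' < m" "m < j'"
    and lt: "i < i' \<or> i = i' \<and> j < j'" for i j i' j'
  proof -
    have a: "adj (f i) (f j)" "adj (f i') (f j')" "Suc i < j" "Suc i' < j'" "j < l" "j' < l"
      using c by (auto simp: chord_at_def)
    have per: "f l = f 0" "f (i + l) = f i" "f (i' + l) = f i'" using periodic[of 0] periodic by auto
    consider "i = i'" "j < j'" | "i < i'" "j' \<le> j" | "i < i'" "j < j'" using lt by linarith
    then show False
    proof cases
      case 1
      then show False using no_short_chord[OF a(2,1)] a c by auto
    next
      case 2
      then show False using no_short_chord[OF a(1,2)] a c by auto
    next
      case 3
      have b: "adj (f m) (f l)" "adj (f j) (f (i + l))" "adj (f j') (f (i' + l))"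
        using per chord_0 a adj_sym by auto
      have "l \<le> (m - i) + (l - j) + 2"
        by (rule crossing_size[OF a(1,2) b(1)]) (use 3 a c in auto)
      moreover have "l \<le> (j - i') + (i + l - j') + 2"
        by (rule crossing_size[OF a(2) b(1,2)]) (use 3 a c in auto)
      moreover have "l \<le> (j' - m) + (i' + l - l) + 2"
        by (rule crossing_size[OF b(1,2,3)]) (use 3 a c in auto)
      ultimately show False using 3 a c l by linarith
    qed
  qed
  note x = chord_at_crosses[OF c(1,2)] chord_at_crosses[OF c(3,4)]
  show ?thesis
  proof (rule ccontr)
    assume "(i, j) \<noteq> (i', j')"
    then consider "i < i' \<or> i = i' \<and> j < j'" | "i' < i \<or> i' = i \<and> j' < j" by fastforce
    then show False using *[of i j i' j'] *[of i' j' i j] c x by cases auto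
  qed
qed

lemma few_chord_ends:
  assumes "7 \<le> l"
  obtains D where "f 0 \<in> D" "card D \<le> 4" "finite D"
    "\<And>i j. chord_at i j \<Longrightarrow> f i \<in> D \<and> f j \<in> D"
proof (cases "\<exists>i j. chord_at i j \<and> (i, j) \<noteq> (0, m)")
  case True
  then obtain i j where ij: "chord_at i j" "(i, j) \<noteq> (0, m)" by blast
  show thesis
  proof (rule that[of "{f 0, f m, f i, f j}"])
    fix i' j' assume "chord_at i' j'"
    then show "f i' \<in> {f 0, f m, f i, f j} \<and> f j' \<in> {f 0, f m, f i, f j}"
      using chord_at_unique[OF assms ij, of i' j'] by (cases "(i', j') = (0, m)") auto
  qed (auto simp: card_insert_if)
next
  case False
  show thesis by (rule that[of "{f 0, f m}"]) (use False in \<open>auto simp: card_insert_if\<close>)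
qed

lemma long_cycle_structure:
  assumes l: "7 \<le> l"
  obtains D where "card D \<le> 4" "finite D" "\<And>x. x \<in> range f - D \<Longrightarrow> card (nbrs (range f) x) \<le> 2"
    "\<And>S. S \<subseteq> range f - D \<Longrightarrow> \<exists>I\<subseteq>S. indep I \<and> card S \<le> 2 * card I"
proof -
  obtain D where D: "f 0 \<in> D" "card D \<le> 4" "finite D" "\<And>i j. chord_at i j \<Longrightarrow> f i \<in> D \<and> f j \<in> D"
    using few_chord_ends[OF l] by metis
  have consec: "j = Suc i" if "i < j" "j < l" "adj (f i) (f j)" "f i \<notin> D" for i j
  proof (rule ccontr)
    assume "j \<noteq> Suc i"
    moreover have "i \<noteq> 0" using that D(1) by metis
    ultimately have "chord_at i j" using that by (simp add: chord_at_def)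
    then show False using D(4) that by blast
  qed
  have consec': "j = Suc i \<or> i = 0 \<and> j = l - 1" if "i < j" "j < l" "adj (f i) (f j)" "f j \<notin> D" for i j
  proof (rule ccontr)
    assume "\<not> ?thesis"
    then have "chord_at i j" using that by (simp add: chord_at_def)
    then show False using D(4) that by blast
  qed
  show thesis
  proof (rule that[OF D(2,3)])
    fix x assume x: "x \<in> range f - D"
    then obtain i where i: "i < l" "x = f i" unfolding cycle_image[symmetric] by auto
    have "nbrs (range f) x \<subseteq> {f (Suc i), f (i - 1)}"
    proof
      fix y assume "y \<in> nbrs (range f) x"
      then obtain j where j: "j < l" "y = f j" "adj (f i) (f j)"
        unfolding cycle_image[symmetric] i nbrs_def by auto
      then have "i \<noteq> j" using adj_irrefl by metis
      then consider "i < j" | "j < i" by linarith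
      then show "y \<in> {f (Suc i), f (i - 1)}"
      proof cases
        case 1
        then show ?thesis using consec[OF 1 j(1,3)] j x i by simp
      next
        case 2
        then show ?thesis using consec'[OF 2 i(1) adj_sym[OF j(3)]] j x i periodic[of 0] by auto
      qed
    qed
    then have "card (nbrs (range f) x) \<le> card {f (Suc i), f (i - 1)}" by (intro card_mono) auto
    also have "\<dots> \<le> 2" by (simp add: card_insert_if)
    finally show "card (nbrs (range f) x) \<le> 2" .
  next
    fix S assume S: "S \<subseteq> range f - D"
    \<comment> \<open>Since \<open>f 0\<close> is in \<open>D\<close>, the set \<open>S\<close>
      avoids it and the edge closing the cycle is irrelevant: index parity is a proper colouring of
      \<open>S\<close> for odd \<open>l\<close> too.\<close>
    let ?P = "\<lambda>b. {i. i < l \<and> f i \<in> S \<and> even i = b}"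
    have ind: "indep (f ` ?P b)" for b
      unfolding indep_def
    proof (intro ballI notI)
      fix x y assume "x \<in> f ` ?P b" "y \<in> f ` ?P b" and xy: "adj x y"
      then obtain i j where ij: "i < l" "f i \<in> S" "even i = b" "j < l" "f j \<in> S" "even j = b" "x = f i" "y = f j"
        by auto
      then have "i \<noteq> j" using xy adj_irrefl by metis
      then consider "i < j" | "j < i" by linarith
      then show False
      proof cases
        case 1
        then show False using consec[of i j] ij xy S by auto
      next
        case 2
        then show False using consec[of j i] ij adj_sym[OF xy] S by auto
      qed
    qed
    have "S \<subseteq> f ` ?P True \<union> f ` ?P False" using S unfolding cycle_image[symmetric] by fastforce
    then have "card S \<le> card (f ` ?P True \<union> f ` ?P False)" by (intro card_mono) auto
    then have "card S \<le> card (f ` ?P True) + card (f ` ?P False)"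
      using card_Un_le[of "f ` ?P True" "f ` ?P False"] by linarith
    then consider "card S \<le> 2 * card (f ` ?P True)" | "card S \<le> 2 * card (f ` ?P False)" by linarith
    then show "\<exists>I\<subseteq>S. indep I \<and> card S \<le> 2 * card I"
    proof cases
      case 1
      then show ?thesis using ind[of True] by (intro exI[of _ "f ` ?P True"]) auto
    next
      case 2
      then show ?thesis using ind[of False] by (intro exI[of _ "f ` ?P False"]) auto
    qed
  qed
qed

end

lemma (in simple_graph) shortest_chordedE:
  assumes C: "chorded C" "C \<subseteq> V" and shortest: "\<And>X. X \<subseteq> V \<Longrightarrow> chorded X \<Longrightarrow> card C \<le> card X"
  obtains f m where "shortest_chorded adj V f (card C) m" "range f = C"
proof -
  obtain u as v bs where *: "C = set (u # as @ v # bs)" "distinct (u # as @ v # bs)"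
    "successively adj (u # as @ v # bs)" "adj (last bs) u" "adj u v" "as \<noteq> []" "bs \<noteq> []"
    using C(1) unfolding chorded_def by blast
  define xs where "xs = u # as @ v # bs"
  define l where "l = length xs"
  have l: "l = card C" using *(1,2) distinct_card unfolding l_def xs_def by metis
  have l_pos: "0 < l" by (simp add: l_def xs_def)
  let ?f = "\<lambda>i. xs ! (i mod l)"
  have sub: "range ?f \<subseteq> C" using *(1) l_pos by (auto simp: l_def xs_def[symmetric])
  have "shortest_chorded adj V ?f l (Suc (length as))"
  proof
    fix i
    show "adj (xs ! (i mod l)) (xs ! (Suc i mod l))"
    proof (cases "Suc (i mod l) = l")
      case True
      then have "i mod l = l - 1" "Suc i mod l = 0" using l_pos by (auto simp: mod_Suc)
      moreover have "last xs = last bs" "xs ! 0 = u" using *(7) by (auto simp: xs_def)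
      ultimately show ?thesis using *(4) l_pos by (simp add: last_conv_nth l_def)
    next
      case False
      then have "Suc i mod l = Suc (i mod l)" "Suc (i mod l) < l"
        using l_pos by (auto simp: mod_Suc intro: Suc_lessI)
      then show ?thesis using *(3) unfolding xs_def[symmetric] successively_conv_nth l_def by simp
    qed
    show "xs ! ((i + l) mod l) = xs ! (i mod l)" by simp
    show "xs ! (i mod l) \<in> V" using sub C(2) by blast
  next
    fix a
    show "inj_on ?f {a..<a + l}"
    proof (rule inj_onI)
      fix i j assume ij: "i \<in> {a..<a + l}" "j \<in> {a..<a + l}" "xs ! (i mod l) = xs ! (j mod l)"
      have "i mod l = j mod l" using ij(3) *(2) l_pos
        by (simp add: nth_eq_iff_index_eq l_def xs_def[symmetric])
      then have "l dvd i - j \<or> i < j" "l dvd j - i \<or> j < i"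
        using mod_eq_dvd_iff_nat[of j i l] mod_eq_dvd_iff_nat[of i j l] by (cases i j rule: linorder_cases; simp)+
      moreover have "i - j < l" "j - i < l" using ij(1,2) by auto
      ultimately have "i - j = 0 \<or> i < j" "j - i = 0 \<or> j < i" using nat_dvd_not_less by blast+
      then show "i = j" by auto
    qed
  next
    show "adj (xs ! (0 mod l)) (xs ! (Suc (length as) mod l))"
      using *(5) *(7) by (simp add: l_def xs_def nth_append)
    show "2 \<le> Suc (length as)" "Suc (length as) + 2 \<le> l"
      using *(6,7) by (auto simp: l_def xs_def Suc_le_eq)
  next
    fix X assume "X \<subseteq> V" "chorded X"
    then show "l \<le> card X" using shortest l by simp
  qed
  moreover have "C \<subseteq> range ?f"
  proof
    fix x assume "x \<in> C"
    then obtain i where "i < l" "x = xs ! i" using *(1) by (auto simp: xs_def[symmetric] l_def in_set_conv_nth)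
    then show "x \<in> range ?f" by (intro image_eqI[of _ _ i]) auto
  qed
  ultimately show thesis using that sub l by blast
qed

section \<open>Packing chorded cycles\<close>

definition packing :: "('a set \<Rightarrow> bool) \<Rightarrow> nat \<Rightarrow> 'a set \<Rightarrow> bool" where
  "packing R n V \<longleftrightarrow> (\<exists>F. finite F \<and> card F = n \<and> disjoint F \<and> (\<forall>X\<in>F. X \<subseteq> V \<and> R X))"

lemma packing_0: "packing R 0 V"
  unfolding packing_def by (intro exI[of _ "{}"]) (simp add: disjoint_def)

lemma packing_1: "X \<subseteq> V \<Longrightarrow> R X \<Longrightarrow> packing R (Suc 0) V"
  unfolding packing_def by (intro exI[of _ "{X}"]) (simp add: disjoint_def)

lemma packing_mono_prop: "packing R n V \<Longrightarrow> (\<And>X. R X \<Longrightarrow> R' X) \<Longrightarrow> packing R' n V"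
  unfolding packing_def by blast

lemma packing_le:
  assumes "packing R n V" "m \<le> n"
  shows "packing R m V"
proof -
  obtain F where F: "finite F" "card F = n" "disjoint F" "\<forall>X\<in>F. X \<subseteq> V \<and> R X"
    using assms(1) unfolding packing_def by blast
  obtain F' where F': "F' \<subseteq> F" "card F' = m" "finite F'"
    using assms(2) F(2) obtain_subset_with_card_n by metis
  then have "disjoint F'" "\<forall>X\<in>F'. X \<subseteq> V \<and> R X" using F unfolding disjoint_def by blast+
  then show ?thesis using F' unfolding packing_def by blast
qed

text \<open>Without nonemptiness, an empty set in both families would be counted only once in their
  union.\<close>

lemma packing_Un:
  assumes "packing R m A" "packing R n B" "A \<inter> B = {}" "A \<union> B \<subseteq> V" and ne: "\<And>X. R X \<Longrightarrow> X \<noteq> {}"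
  shows "packing R (m + n) V"
proof -
  obtain F where F: "finite F" "card F = m" "disjoint F" "\<And>X. X \<in> F \<Longrightarrow> X \<subseteq> A \<and> R X"
    using assms(1) unfolding packing_def by blast
  obtain G where G: "finite G" "card G = n" "disjoint G" "\<And>X. X \<in> G \<Longrightarrow> X \<subseteq> B \<and> R X"
    using assms(2) unfolding packing_def by blast
  have cross: "X \<inter> Y = {}" if "X \<in> F" "Y \<in> G" for X Y using F(4)[OF that(1)] G(4)[OF that(2)] assms(3) by blast
  have "X \<notin> G" if "X \<in> F" for X
    using cross[OF that, of X] F(4)[OF that] ne[of X] by auto
  then have "F \<inter> G = {}" by blast
  then have "card (F \<union> G) = m + n" using F G by (simp add: card_Un_disjoint)
  moreover have "disjoint (F \<union> G)" using F(3) G(3) cross unfolding disjoint_def by (metis Int_commute Un_iff)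
  moreover have "X \<subseteq> V \<and> R X" if "X \<in> F \<union> G" for X
    using that F(4)[of X] G(4)[of X] assms(4) by blast
  ultimately show ?thesis using F(1) G(1) unfolding packing_def by blast
qed

lemma packing_refine:
  assumes "finite F" "disjoint F" "\<And>X. X \<in> F \<Longrightarrow> \<exists>Y\<subseteq>X. R Y" and ne: "\<And>X. R X \<Longrightarrow> X \<noteq> {}"
  shows "packing R (card F) (\<Union>F)"
proof -
  obtain g where g: "\<And>X. X \<in> F \<Longrightarrow> g X \<subseteq> X \<and> R (g X)" using assms(3) by metis
  have dj: "g X \<inter> g Y = {}" if "X \<in> F" "Y \<in> F" "X \<noteq> Y" for X Y
    using assms(2) g[OF that(1)] g[OF that(2)] that unfolding disjoint_def by blast
  have "inj_on g F"
  proof (rule inj_onI, rule ccontr)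
    fix X Y assume "X \<in> F" "Y \<in> F" "g X = g Y" "X \<noteq> Y"
    then show False using dj[of X Y] g[of X] ne[of "g X"] by auto
  qed
  then have "card (g ` F) = card F" by (rule card_image)
  moreover have "disjoint (g ` F)" unfolding disjoint_def using dj by auto
  moreover have "X \<subseteq> \<Union>F \<and> R X" if "X \<in> g ` F" for X using that g by blast
  ultimately show ?thesis using assms(1) unfolding packing_def by blast
qed

context simple_graph begin

section \<open>Deleting vertices under the degree condition\<close>

definition few_poor :: "nat \<Rightarrow> nat \<Rightarrow> 'a set \<Rightarrow> bool" where
  "few_poor d t V \<longleftrightarrow> (\<forall>I\<subseteq>V. indep I \<longrightarrow> (\<forall>v\<in>I. card (nbrs V v) \<le> d) \<longrightarrow> card I < t)"

lemma chorded_card: "chorded X \<Longrightarrow> 4 \<le> card X"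
proof -
  assume "chorded X"
  then obtain u as v bs where *: "X = set (u # as @ v # bs)" "distinct (u # as @ v # bs)" "as \<noteq> []" "bs \<noteq> []"
    unfolding chorded_def by blast
  then have "card X = length (u # as @ v # bs)" using distinct_card by metis
  then show ?thesis using *(3,4) by (cases as; cases bs) auto
qed

lemma chorded_nonempty: "chorded X \<Longrightarrow> X \<noteq> {}"
  using chorded_card[of X] by auto

lemma nbrs_diff:
  assumes "finite V" "U \<subseteq> V"
  shows "card (nbrs V v) = card (nbrs (V - U) v) + card (nbrs U v)"
proof -
  have "nbrs V v = nbrs (V - U) v \<union> nbrs U v" "nbrs (V - U) v \<inter> nbrs U v = {}"
    using assms(2) by (auto simp: nbrs_def)
  then show ?thesis using assms by (simp add: card_Un_disjoint nbrs_def finite_subset)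
qed

text \<open>Putting \<open>U\<close> back raises a degree by at most \<open>3 * s\<close>, and
  \<open>3 * (k - s) - 1 + 3 * s = 3 * k - 1\<close> because \<open>s < k\<close> keeps the
  subtractions exact.\<close>

lemma few_poor_delete:
  assumes "few_poor (3 * k - 1) t V" "finite V" "U \<subseteq> V" "s < k"
    and U: "\<And>w. w \<in> V - U \<Longrightarrow> card (nbrs U w) \<le> 3 * s"
  shows "few_poor (3 * (k - s) - 1) t (V - U)"
  unfolding few_poor_def
proof (intro allI impI)
  fix I assume I: "I \<subseteq> V - U" "indep I" "\<forall>v\<in>I. card (nbrs (V - U) v) \<le> 3 * (k - s) - 1"
  have "card (nbrs V v) \<le> 3 * k - 1" if "v \<in> I" for v
  proof -
    have "card (nbrs (V - U) v) \<le> 3 * (k - s) - 1" "card (nbrs U v) \<le> 3 * s" using I U that by auto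
    then show ?thesis using nbrs_diff[OF assms(2,3), of v] assms(4) by linarith
  qed
  then show "card I < t" using assms(1) I unfolding few_poor_def by blast
qed

abbreviation chorded4 :: "'a set \<Rightarrow> bool" where
  "chorded4 X \<equiv> chorded X \<and> card X = 4"

text \<open>A crude bound, for the existence of a largest packing.\<close>

lemma packing4_le_card: "finite V \<Longrightarrow> packing chorded4 n V \<Longrightarrow> n < Suc (card (Pow V))"
  unfolding packing_def less_Suc_eq_le by (metis Pow_iff card_mono finite_Pow_iff subsetI)

text \<open>Growing every set of a maximum packing of chorded 4-sets as far as possible leaves sets of at
  most 7 vertices to each of which every remaining vertex sends at most 3 edges.\<close>

lemma grown_packing:
  assumes fin: "finite V" and s: "packing chorded4 s V" "\<not> packing chorded4 (Suc s) V"
  obtains F where "finite F" "card F = s" "disjoint F" "\<And>X. X \<in> F \<Longrightarrow> X \<subseteq> V \<and> grown X \<and> card X \<le> 7"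
    "\<And>X w. X \<in> F \<Longrightarrow> w \<in> V - \<Union>F \<Longrightarrow> card (nbrs X w) \<le> 3"
proof -
  let ?P = "\<lambda>F. finite F \<and> card F = s \<and> disjoint F \<and> (\<forall>X\<in>F. X \<subseteq> V \<and> grown X)"
  have "\<exists>F. ?P F" using s(1) unfolding packing_def by (metis grown.base)
  then obtain F0 where "?P F0" by blast
  moreover have "\<forall>F. ?P F \<longrightarrow> card (\<Union>F) < Suc (card V)"
    using fin by (auto intro!: card_mono simp: less_Suc_eq_le)
  ultimately have "\<exists>F. ?P F \<and> (\<forall>F'. ?P F' \<longrightarrow> card (\<Union>F') \<le> card (\<Union>F))"
    by (rule ex_has_greatest_nat)
  then obtain F where F: "?P F" and max: "\<And>F'. ?P F' \<Longrightarrow> card (\<Union>F') \<le> card (\<Union>F)"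
    by blast
  have sub: "X \<subseteq> V" "grown X" "finite X" if "X \<in> F" for X using F that grown_finite by auto
  have UF: "\<Union>F \<subseteq> V" using sub by blast
  have rest: "packing chorded4 (s - 1) (\<Union>(F - {X}))" if "X \<in> F" for X
  proof -
    have "packing chorded4 (card (F - {X})) (\<Union>(F - {X}))"
    proof (rule packing_refine)
      show "finite (F - {X})" using F by simp
      show "disjoint (F - {X})" using F unfolding disjoint_def by blast
      show "\<exists>Z\<subseteq>Y. chorded4 Z" if "Y \<in> F - {X}" for Y using that sub grown_chorded4 by blast
    qed (use chorded_nonempty in auto)
    then show ?thesis using that F by simp
  qed
  have dj: "X \<inter> \<Union>(F - {X}) = {}" if "X \<in> F" for X
    using F that unfolding disjoint_def by blast
  \<comment> \<open>Two chorded 4-sets inside \<open>X\<close> and one inside each other member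
    would make \<open>s + 1\<close>.\<close>
  have card7: "card X \<le> 7" if X: "X \<in> F" for X
  proof (rule ccontr)
    assume "\<not> ?thesis"
    then obtain A B where AB: "A \<subseteq> X" "B \<subseteq> X" "A \<inter> B = {}" "chorded A" "chorded B" "card A = 4" "card B = 4"
      using grown_split[of X] sub[OF X] by auto
    have ne: "\<And>Y. chorded4 Y \<Longrightarrow> Y \<noteq> {}" using chorded_nonempty by auto
    have "packing chorded4 (Suc 0 + Suc 0) X"
      by (rule packing_Un[of _ _ A _ B]) (use AB chorded_nonempty in \<open>auto intro!: packing_1\<close>)
    moreover have "X \<union> \<Union>(F - {X}) \<subseteq> V" using UF X by blast
    ultimately have "packing chorded4 (Suc 0 + Suc 0 + (s - 1)) V"
      using packing_Un[OF _ rest[OF X] dj[OF X] _ ne] by blast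
    moreover have "0 < s" using F X by (auto simp: card_gt_0_iff)
    ultimately show False using s(2) by simp
  qed
  \<comment> \<open>Otherwise \<open>X\<close> could absorb \<open>w\<close>, and the union of the
    family would grow.\<close>
  have le3: "card (nbrs X w) \<le> 3" if X: "X \<in> F" and w: "w \<in> V - \<Union>F" for X w
  proof (rule ccontr)
    assume "\<not> ?thesis"
    moreover have wX: "w \<notin> X" using X w by blast
    ultimately have g: "grown (insert w X)" using grown.step[OF sub(2)[OF X] wX] by simp
    let ?F = "insert (insert w X) (F - {X})"
    have "insert w X \<notin> F - {X}" using w by blast
    then have "card ?F = s" using F X card_Suc_Diff1[of F X] by simp
    moreover have "disjoint ?F"
    proof -
      have "insert w X \<inter> Y = {}" if "Y \<in> F - {X}" for Y using that dj[OF X] w by blast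
      moreover have "disjoint (F - {X})" using F unfolding disjoint_def by blast
      ultimately show ?thesis unfolding disjoint_def by (metis Int_commute insert_iff)
    qed
    moreover have "\<forall>Y\<in>?F. Y \<subseteq> V \<and> grown Y" using g sub w X by auto
    ultimately have "card (\<Union>?F) \<le> card (\<Union>F)" using F by (intro max) auto
    moreover have "\<Union>?F = insert w (\<Union>F)" using X by blast
    moreover have "finite (\<Union>F)" using UF fin finite_subset by blast
    ultimately show False using w by simp
  qed
  show thesis by (rule that[of F]) (use F sub card7 le3 in auto)
qed

text \<open>The edges between \<open>C\<close> and \<open>V - C\<close> are counted from both sides:
  vertices of \<open>C\<close> with degree at least \<open>3 * k\<close> have mostly at most two
  neighbours on \<open>C\<close>, and so has every vertex outside.\<close>

lemma card_outside_long_cycle: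
  assumes "shortest_chorded adj V f l m" and C: "range f = C" and fin: "finite V"
    and poor: "few_poor (3 * k - 1) t V" and l: "10 * t \<le> l" "1 \<le> t" and k: "1 \<le> k"
  shows "(3 * k - 2) * (4 * t - 1) \<le> card (V - C)"
proof -
  interpret shortest_chorded adj V f l m by fact
  have l7: "7 \<le> l" using l by simp
  have CV: "C \<subseteq> V" using C in_V by auto
  have finC: "finite C" using finite_subset[OF CV fin] .
  obtain D where D: "card D \<le> 4" "finite D" "\<And>x. x \<in> C - D \<Longrightarrow> card (nbrs C x) \<le> 2"
    "\<And>S. S \<subseteq> C - D \<Longrightarrow> \<exists>I\<subseteq>S. indep I \<and> card S \<le> 2 * card I"
    using long_cycle_structure[OF l7] C by metis
  let ?S = "{x \<in> C - D. card (nbrs V x) \<le> 3 * k - 1}" and ?R = "{x \<in> C - D. 3 * k \<le> card (nbrs V x)}"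
  obtain I where I: "I \<subseteq> ?S" "indep I" "card ?S \<le> 2 * card I" using D(4)[of ?S] by auto
  have "card I < t" using poor I CV unfolding few_poor_def by blast
  then have S: "card ?S \<le> 2 * (t - 1)" using I(3) by linarith
  have "card (C - D) = card ?S + card ?R"
    using finC k by (subst card_Un_disjoint[symmetric]) (auto intro!: arg_cong[of _ _ card])
  moreover have "l - 4 \<le> card (C - D)"
    using diff_card_le_card_Diff[OF D(2), of C] D(1) card_cycle[unfolded C] by linarith
  \<comment> \<open>\<open>10 * t - 4 - 2 * (t - 1)\<close>: at most 4 vertices lie in
    \<open>D\<close>, and at most \<open>2 * (t - 1)\<close> others have low degree.\<close>
  ultimately have R: "8 * t - 2 \<le> card ?R" using S l by linarith
  have deg: "3 * k - 2 \<le> card (nbrs (V - C) x)" if "x \<in> ?R" for x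
    using that D(3)[of x] nbrs_diff[OF fin CV, of x] by auto
  have "(3 * k - 2) * (8 * t - 2) \<le> (3 * k - 2) * card ?R" using R by simp
  also have "\<dots> = (\<Sum>x\<in>?R. 3 * k - 2)" by simp
  also have "\<dots> \<le> (\<Sum>x\<in>?R. card (nbrs (V - C) x))" using deg by (intro sum_mono)
  also have "\<dots> \<le> (\<Sum>x\<in>C. card (nbrs (V - C) x))" using finC by (intro sum_mono2) auto
  also have "\<dots> = (\<Sum>w\<in>V - C. card {x \<in> C. adj x w})"
    unfolding nbrs_def using finC fin by (intro sum_card_swap) auto
  also have "\<dots> \<le> (\<Sum>w\<in>V - C. 2)"
  proof (rule sum_mono)
    fix w assume w: "w \<in> V - C"
    have "{x \<in> C. adj x w} = nbrs C w" using adj_sym unfolding nbrs_def by blast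
    then show "card {x \<in> C. adj x w} \<le> 2" using outside_nbrs_le_2[OF l7, of w] w C by simp
  qed
  also have "\<dots> = 2 * card (V - C)" by simp
  finally have "(3 * k - 2) * (8 * t - 2) \<le> 2 * card (V - C)" .
  moreover have "8 * t - 2 = 2 * (4 * t - 1)" by simp
  ultimately show ?thesis by (metis mult.left_commute mult_le_cancel1 zero_less_numeral)
qed

theorem disjoint_chorded_packing:
  assumes "1 \<le> t" "finite V" "few_poor (3 * k - 1) t V" "(10 * t - 1) * (k - 1) + 12 * t \<le> card V"
  shows "packing chorded k V"
  using assms(2-)
proof (induction k arbitrary: V rule: less_induct)
  case (less k)
  show ?case
  proof (cases "k = 0")
    case True
    then show ?thesis using packing_0 by simp
  next
    case k0: False
    have "\<exists>s. packing chorded4 s V \<and> (\<forall>s'. packing chorded4 s' V \<longrightarrow> s' \<le> s)"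
      using ex_has_greatest_nat[of "\<lambda>s. packing chorded4 s V" 0 "\<lambda>s. s" "Suc (card (Pow V))"]
        packing_0 packing4_le_card[OF less.prems(1)] by blast
    then obtain s where s: "packing chorded4 s V" "\<And>s'. packing chorded4 s' V \<Longrightarrow> s' \<le> s" by blast
    consider "k \<le> s" | "0 < s" "s < k" | "s = 0" by linarith
    then show ?thesis
    proof cases
      case 1
      then show ?thesis using packing_mono_prop[OF packing_le[OF s(1)]] by blast
    next
      case 2
      have "\<not> packing chorded4 (Suc s) V" using s(2)[of "Suc s"] by auto
      from grown_packing[OF less.prems(1) s(1) this] obtain F where
        F: "finite F" "card F = s" "disjoint F" "\<And>X. X \<in> F \<Longrightarrow> X \<subseteq> V \<and> grown X \<and> card X \<le> 7"
          "\<And>X w. X \<in> F \<Longrightarrow> w \<in> V - \<Union>F \<Longrightarrow> card (nbrs X w) \<le> 3" by blast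
      let ?U = "\<Union>F"
      have U: "?U \<subseteq> V" using F(4) by blast
      have "card ?U \<le> (\<Sum>X\<in>F. card X)" using F(1) card_Union_le_sum_card by blast
      also have "\<dots> \<le> 7 * s" using sum_bounded_above[of F card 7] F(2,4) by simp
      finally have "card ?U \<le> 7 * s" .
      then have card': "card V \<le> card (V - ?U) + 7 * s"
        using U less.prems(1) by (metis add.commute add_le_mono1 card_Diff_subset card_mono finite_subset le_add_diff_inverse2)
      have nb: "card (nbrs ?U w) \<le> 3 * s" if "w \<in> V - ?U" for w
      proof -
        have "nbrs ?U w = (\<Union>X\<in>F. nbrs X w)" by (auto simp: nbrs_def)
        then have "card (nbrs ?U w) \<le> (\<Sum>X\<in>F. card (nbrs X w))" using card_UN_le[OF F(1)] by simp
        also have "\<dots> \<le> 3 * s" using sum_bounded_above[of F "\<lambda>X. card (nbrs X w)" 3] F(2) F(5)[OF _ that] by simp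
        finally show ?thesis .
      qed
      have "packing chorded (k - s) (V - ?U)"
      proof (rule less.IH)
        show "k - s < k" using 2 by simp
        show "finite (V - ?U)" using less.prems by simp
        show "few_poor (3 * (k - s) - 1) t (V - ?U)"
          by (rule few_poor_delete[OF less.prems(2,1) U 2(2) nb])
        have "k - 1 = (k - s - 1) + s" using 2 by simp
        then have "(10 * t - 1) * (k - 1) = (10 * t - 1) * (k - s - 1) + (10 * t - 1) * s"
          by (metis distrib_left)
        \<comment> \<open>A member costs at most 7 vertices, and the allowance per cycle is at least
          9.\<close>
        moreover have "7 * s \<le> (10 * t - 1) * s" using assms(1) by (intro mult_le_mono1) simp
        ultimately show "(10 * t - 1) * (k - s - 1) + 12 * t \<le> card (V - ?U)"
          using less.prems(3) card' by linarith
      qed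
      moreover have "packing chorded s ?U"
      proof -
        have "packing chorded (card F) ?U"
        proof (rule packing_refine[OF F(1,3)])
          show "\<exists>Y\<subseteq>X. chorded Y" if "X \<in> F" for X using F(4)[OF that] grown_chorded4 by blast
        qed (rule chorded_nonempty)
        then show ?thesis using F(2) by simp
      qed
      ultimately have "packing chorded ((k - s) + s) V"
        using U by (intro packing_Un[of _ _ "V - ?U" _ ?U]) (auto simp: chorded_nonempty)
      then show ?thesis using 2 by simp
    next
      case 3
      have no4: "card X \<noteq> 4" if "X \<subseteq> V" "chorded X" for X
        using s(2)[OF packing_1[of X V]] that 3 by auto
      have "\<exists>X\<subseteq>V. chorded X"
      \<comment> \<open>Degrees up to 2 are below the bound \<open>3 * k - 1\<close>, so such
        independent sets have at most \<open>t - 1\<close> elements; the summand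
        \<open>12 * t\<close> exceeds \<open>12 * (t - 1)\<close>.\<close>
      proof (rule ex_chorded[OF less.prems(1), of "t - 1"])
        show "card I \<le> t - 1" if I: "I \<subseteq> V" "\<forall>v\<in>I. card (nbrs V v) \<le> 2" "indep I" for I
        proof -
          have "\<forall>v\<in>I. card (nbrs V v) \<le> 3 * k - 1" using I(2) k0 by fastforce
          then have "card I < t" using less.prems(2) I unfolding few_poor_def by blast
          then show ?thesis by simp
        qed
        show "12 * (t - 1) < card V" using less.prems(3) assms(1) by simp
      qed
      then have "\<exists>C. (C \<subseteq> V \<and> chorded C) \<and> (\<forall>X. X \<subseteq> V \<and> chorded X \<longrightarrow> card C \<le> card X)"
        using ex_has_least_nat[of "\<lambda>X. X \<subseteq> V \<and> chorded X" _ card] by metis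
      then obtain C where C: "C \<subseteq> V" "chorded C" "\<And>X. X \<subseteq> V \<Longrightarrow> chorded X \<Longrightarrow> card C \<le> card X" by blast
      obtain f m where f: "shortest_chorded adj V f (card C) m" "range f = C"
        using shortest_chordedE[OF C(2,1,3)] by blast
      interpret S: shortest_chorded adj V f "card C" m by (rule f(1))
      have C5: "5 \<le> card C" using chorded_card[OF C(2)] no4[OF C(1,2)] by simp
      have one: "packing chorded (Suc 0) C" using C(2) by (intro packing_1) auto
      have "packing chorded (k - 1) (V - C)"
      \<comment> \<open>Deletion with \<open>s = 1\<close> requires \<open>1 < k\<close>.\<close>
      proof (cases "k = 1")
        case True
        then show ?thesis using packing_0 by simp
      next
        case False
        then have k: "1 < k" using k0 by simp
        have finC: "finite C" using C(1) less.prems(1) finite_subset by blast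
        have cardV: "card V = card (V - C) + card C"
          using C(1) less.prems(1) finC by (metis card_Diff_subset card_mono le_add_diff_inverse2)
        show ?thesis
        proof (rule less.IH)
          show "k - 1 < k" "finite (V - C)" using k less.prems by simp_all
          show "few_poor (3 * (k - 1) - 1) t (V - C)"
            using few_poor_delete[OF less.prems(2,1) C(1) k] S.outside_nbrs_le_3[OF C5] f(2) by simp
          show "(10 * t - 1) * (k - 1 - 1) + 12 * t \<le> card (V - C)"
          proof (cases "card C < 10 * t")
            case True
            have "(10 * t - 1) * (k - 1) = (10 * t - 1) * (k - 1 - 1) + (10 * t - 1)"
              using k by (cases "k - 1") auto
            then show ?thesis using less.prems(3) cardV True by linarith
          next
            case False
            have "(3 * k - 2) * (4 * t - 1) \<le> card (V - C)"
              using card_outside_long_cycle[OF f less.prems(1,2)] False assms(1) k by simp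
            moreover have "(10 * t - 1) * (k - 1 - 1) + 12 * t \<le> (3 * k - 2) * (4 * t - 1)"
            proof -
              \<comment> \<open>After these substitutions the two sides differ by
                \<open>2 * k' * t' + 4 * t'\<close>.\<close>
              obtain k' where k': "k = k' + 2" using k by (auto dest: less_imp_Suc_add)
              obtain t' where t': "t = t' + 1" using assms(1) by (auto dest: le_Suc_ex)
              show ?thesis unfolding k' t' by (simp add: algebra_simps)
            qed
            ultimately show ?thesis by simp
          qed
        qed
      qed
      then have "packing chorded ((k - 1) + Suc 0) V"
        using one C(1) by (intro packing_Un[of _ _ "V - C" _ C]) (auto simp: chorded_nonempty)
      then show ?thesis using k0 by simp
    qed
  qed
qed

end

section \<open>Complete bipartite graphs and the main theorem\<close>

lemma closed_walk_zip:
  assumes "xs \<noteq> []"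
  shows "pre_digraph.cas (with_proj G) (hd xs) (zip xs (tl xs @ [w])) w
    \<and> pre_digraph.awalk_verts (with_proj G) (hd xs) (zip xs (tl xs @ [w])) = xs @ [w]"
  using assms
proof (induction xs rule: list_nonempty_induct)
  case (single x)
  then show ?case by (simp add: pre_digraph.cas.simps pre_digraph.awalk_verts.simps)
next
  case (cons x xs)
  then show ?case
    by (cases xs) (simp_all add: pre_digraph.cas.simps pre_digraph.awalk_verts.simps)
qed

lemma cas_map:
  assumes "pre_digraph.cas (with_proj G) u p w" "p \<noteq> []"
  shows "hd (map fst p) = u \<and> map snd p = tl (map fst p) @ [w]
    \<and> pre_digraph.awalk_verts (with_proj G) u p = map fst p @ [w]"
  using assms
proof (induction p arbitrary: u)
  case (Cons e p)
  then show ?case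
    by (cases p) (auto simp: pre_digraph.cas.simps pre_digraph.awalk_verts.simps)
qed simp

lemma zip_functional:
  assumes "distinct xs" "(a, b) \<in> set (zip xs ys)" "(a, b') \<in> set (zip xs ys)"
  shows "b = b'"
proof -
  obtain i where i: "xs ! i = a" "ys ! i = b" "i < length xs" using assms(2) by (auto simp: in_set_zip)
  obtain j where j: "xs ! j = a" "ys ! j = b'" "j < length xs" using assms(3) by (auto simp: in_set_zip)
  have "i = j" using assms(1) i j nth_eq_iff_index_eq by metis
  then show ?thesis using i j by simp
qed

lemma simple_graph_of_pair_graph:
  assumes "pair_graph G"
  shows "simple_graph (\<lambda>u v. (u, v) \<in> parcs G)"
proof -
  interpret pair_graph G by fact
  show ?thesis
  proof
    show "(v, u) \<in> parcs G" if "(u, v) \<in> parcs G" for u v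
      using that arcs_symmetric by simp
    show "(v, v) \<notin> parcs G" for v using no_loops[of "(v, v)"] by auto
  qed
qed

lemma degree_eq_card_nbrs:
  assumes "pair_graph G"
  shows "degree G v = card (simple_graph.nbrs (\<lambda>u v. (u, v) \<in> parcs G) (pverts G) v)"
proof -
  interpret pair_graph G by fact
  interpret S: simple_graph "\<lambda>u v. (u, v) \<in> parcs G" by (rule simple_graph_of_pair_graph) fact
  have "out_arcs (with_proj G) v = Pair v ` S.nbrs (pverts G) v"
    using arc_snd_in_verts by (fastforce simp: out_arcs_def S.nbrs_def)
  then show ?thesis by (simp add: out_degree_def card_image inj_on_def)
qed

lemma chorded_cycle_of_chorded:
  assumes G: "pair_graph G" and X: "X \<subseteq> pverts G"
    and ch: "simple_graph.chorded (\<lambda>u v. (u, v) \<in> parcs G) X"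
  shows "\<exists>p. chorded_cycle G p \<and> cycle_verts p = X"
proof -
  interpret S: simple_graph "\<lambda>u v. (u, v) \<in> parcs G" by (rule simple_graph_of_pair_graph) fact
  obtain u as v bs where *: "X = set (u # as @ v # bs)" "distinct (u # as @ v # bs)"
    "successively (\<lambda>u v. (u, v) \<in> parcs G) (u # as @ v # bs)" "(last bs, u) \<in> parcs G" "(u, v) \<in> parcs G"
    "as \<noteq> []" "bs \<noteq> []"
    using ch unfolding S.chorded_def by blast
  define xs where "xs = u # as @ v # bs"
  define p where "p = zip xs (tl xs @ [u])"
  have len: "length (tl xs @ [u]) = length xs" by (simp add: xs_def)
  have fst: "map fst p = xs" unfolding p_def using len by (simp add: map_fst_zip del: length_append)
  then have verts: "cycle_verts p = X" using *(1) unfolding cycle_verts_def xs_def by (metis list.set_map)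
  have walk: "pre_digraph.cas (with_proj G) u p u" "pre_digraph.awalk_verts (with_proj G) u p = xs @ [u]"
    using closed_walk_zip[of xs G u] unfolding p_def by (simp_all add: xs_def)
  have arcs: "set p \<subseteq> parcs G"
  proof
    fix e assume "e \<in> set p"
    then obtain i where i: "i < length xs" "e = (xs ! i, (tl xs @ [u]) ! i)"
      unfolding p_def using len by (auto simp: set_zip)
    show "e \<in> parcs G"
    proof (cases "Suc i < length xs")
      case True
      then have "(tl xs @ [u]) ! i = xs ! Suc i" using True by (auto simp: nth_append nth_tl)
      then show ?thesis using True i *(3) unfolding xs_def[symmetric] successively_conv_nth by simp
    next
      case False
      then have "i = length xs - 1" using i by simp
      moreover have "xs ! (length xs - 1) = last bs" using *(7) by (subst last_conv_nth[symmetric]) (auto simp: xs_def)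
      ultimately show ?thesis using i *(4) by (simp add: nth_append)
    qed
  qed
  have "graph_cycle G p"
    unfolding graph_cycle_def pre_digraph.cycle_def pre_digraph.awalk_def
  proof (intro conjI exI[of _ u])
    show "u \<in> verts (with_proj G)" using X *(1) by auto
    show "distinct (tl (pre_digraph.awalk_verts (with_proj G) u p))"
      unfolding walk using *(2) by (auto simp: xs_def)
    show "3 \<le> length p" "p \<noteq> []" using *(6,7) by (auto simp: p_def xs_def Suc_le_eq)
  qed (use walk arcs in auto)
  moreover have "chord G p (u, v)"
  proof -
    \<comment> \<open>Each vertex is the tail of one arc only, and the arcs leaving \<open>u\<close>
      and \<open>v\<close> end in \<open>hd as\<close> and \<open>hd bs\<close>; so neither
      orientation of the chord is on the cycle.\<close>
    have "(u, hd as) \<in> set p" using *(6) by (cases as) (simp_all add: p_def xs_def)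
    moreover have "(v, hd bs) \<in> set p"
      unfolding p_def in_set_zip by (rule exI[of _ "Suc (length as)"]) (use *(7) in \<open>cases bs; simp add: xs_def nth_append\<close>)
    moreover have "hd as \<noteq> v" "hd bs \<noteq> u" using *(2,6,7) by (cases as; cases bs; auto)+
    ultimately have "(u, v) \<notin> set p" "(v, u) \<notin> set p"
      using zip_functional[of xs _ _ "tl xs @ [u]"] *(2) unfolding p_def xs_def[symmetric] by blast+
    then show ?thesis using *(1,5) verts by (auto simp: chord_def consecutive_on_def)
  qed
  ultimately show ?thesis using verts unfolding chorded_cycle_def by blast
qed

lemma has_disjoint_chorded_cycles_of_packing:
  assumes G: "pair_graph G"
    and pack: "packing (simple_graph.chorded (\<lambda>u v. (u, v) \<in> parcs G)) k (pverts G)"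
  shows "has_disjoint_chorded_cycles k G"
proof -
  let ?ch = "simple_graph.chorded (\<lambda>u v. (u, v) \<in> parcs G)"
  obtain F where F: "finite F" "card F = k" "disjoint F" "\<And>X. X \<in> F \<Longrightarrow> X \<subseteq> pverts G \<and> ?ch X"
    using pack unfolding packing_def by blast
  obtain g where "bij_betw g {0..<card F} F" using ex_bij_betw_nat_finite[OF F(1)] by blast
  then have g: "inj_on g {..<k}" "\<And>i. i < k \<Longrightarrow> g i \<in> F"
    using F(2) by (auto simp: bij_betw_def atLeast0LessThan)
  have "\<forall>i\<in>{..<k}. \<exists>p. chorded_cycle G p \<and> cycle_verts p = g i"
    using chorded_cycle_of_chorded[OF G] F(4) g(2) by (metis lessThan_iff)
  then obtain C where C: "\<And>i. i < k \<Longrightarrow> chorded_cycle G (C i) \<and> cycle_verts (C i) = g i"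
    by (metis lessThan_iff)
  have "disjoint_family_on (\<lambda>i. cycle_verts (C i)) {..<k}"
    unfolding disjoint_family_on_def
  proof (intro ballI impI)
    fix i j assume ij: "i \<in> {..<k}" "j \<in> {..<k}" "i \<noteq> j"
    then have "g i \<noteq> g j" using g(1) by (meson inj_onD)
    then show "cycle_verts (C i) \<inter> cycle_verts (C j) = {}"
      using F(3) g(2) C ij unfolding disjoint_def by simp
  qed
  then show ?thesis unfolding has_disjoint_chorded_cycles_def using C by blast
qed

text \<open>A violating independent set contains one of size exactly \<open>t\<close>, with degree
  sum at most \<open>t * (3 * k - 1)\<close>, one less than \<open>sigma t G\<close>
  permits.\<close>

lemma has_disjoint_chorded_cycles_if_sigma:
  assumes kt: "1 \<le> k" "1 \<le> t" and G: "pair_graph G"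
    and card: "(10 * t - 1) * (k - 1) + 12 * t \<le> card (pverts G)"
    and sigma: "enat (3 * k * t - t + 1) \<le> sigma t G"
  shows "has_disjoint_chorded_cycles k G"
proof -
  interpret pair_graph G by fact
  interpret S: simple_graph "\<lambda>u v. (u, v) \<in> parcs G" by (rule simple_graph_of_pair_graph) fact
  have "S.few_poor (3 * k - 1) t (pverts G)"
    unfolding S.few_poor_def
  proof (intro allI impI, rule ccontr)
    fix I assume I: "I \<subseteq> pverts G" "S.indep I" "\<forall>v\<in>I. card (S.nbrs (pverts G) v) \<le> 3 * k - 1"
      and "\<not> card I < t"
    then obtain X where X: "X \<subseteq> I" "card X = t" by (meson not_less obtain_subset_with_card_n)
    then have "independent_set G X" using I unfolding independent_set_def S.indep_def by blast
    then have "sigma t G \<le> enat (\<Sum>v\<in>X. degree G v)"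
      unfolding sigma_def using X by (intro INF_lower) auto
    then have "3 * k * t - t + 1 \<le> (\<Sum>v\<in>X. degree G v)" using sigma by (metis enat_ord_simps(1) order_trans)
    moreover have "(\<Sum>v\<in>X. degree G v) \<le> card X * (3 * k - 1)"
      using sum_bounded_above[of X "degree G" "3 * k - 1"] I(3) X(1) degree_eq_card_nbrs[OF G] by auto
    moreover have "card X * (3 * k - 1) = 3 * k * t - t" using X(2) by (simp add: diff_mult_distrib2 mult.commute)
    ultimately show False by simp
  qed
  then show ?thesis
    using S.disjoint_chorded_packing[OF kt(2) _ _ card] has_disjoint_chorded_cycles_of_packing[OF G]
    by simp
qed

text \<open>The end of the chord outside \<open>U\<close> has two neighbours on the cycle; together with the other end
  of the chord they are three vertices in \<open>U\<close>.\<close>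

lemma bipartite_chorded_cycle:
  assumes UV: "U \<inter> V = {}" "parcs H = U \<times> V \<union> V \<times> U" and p: "chorded_cycle H p" and fin: "finite U"
  shows "3 \<le> card (cycle_verts p \<inter> U)"
proof -
  obtain u where u: "pre_digraph.awalk (with_proj H) u p u"
    "distinct (tl (pre_digraph.awalk_verts (with_proj H) u p))" and len: "3 \<le> length p"
    using p unfolding chorded_cycle_def graph_cycle_def pre_digraph.cycle_def by blast
  have arcs: "set p \<subseteq> parcs H" and cas: "pre_digraph.cas (with_proj H) u p u"
    using u(1) unfolding pre_digraph.awalk_def by auto
  define xs where "xs = map fst p"
  have ne: "p \<noteq> []" "xs \<noteq> []" using len by (auto simp: xs_def)
  have m: "hd xs = u" "map snd p = tl xs @ [u]" "distinct (tl xs @ [u])"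
    using cas_map[OF cas ne(1)] u(2) ne by (auto simp: xs_def)
  then have rot: "map snd p = rotate1 xs" using ne(2) by (cases xs) auto
  then have dist: "distinct xs" using m by (cases xs) auto
  have verts: "cycle_verts p = set xs" "cycle_verts p = snd ` set p"
    using rot by (auto simp: cycle_verts_def xs_def) (metis image_eqI list.set_map set_rotate1 snd_conv fst_conv)+
  \<comment> \<open>Opposite arcs would sit at positions succeeding each other modulo the length,
    which is at least 3. Hence the two cycle neighbours of a vertex differ.\<close>
  have no_2cycle: False if xy: "(x, y) \<in> set p" "(y, x) \<in> set p" for x y
  proof -
    let ?n = "length xs"
    obtain i j where ij: "i < ?n" "p ! i = (x, y)" "j < ?n" "p ! j = (y, x)"
      using xy unfolding xs_def length_map in_set_conv_nth by blast
    have nxt: "snd (p ! i) = xs ! (Suc i mod ?n)" if "i < ?n" for i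
      using that rot nth_rotate1[of i xs] by (metis length_map nth_map xs_def)
    have cur: "fst (p ! i) = xs ! i" if "i < ?n" for i using that by (simp add: xs_def)
    have n: "0 < ?n" using ne by simp
    have "xs ! (Suc i mod ?n) = xs ! j" "xs ! (Suc j mod ?n) = xs ! i"
      using nxt cur ij by (metis fst_conv snd_conv)+
    then have "Suc i mod ?n = j" "Suc j mod ?n = i"
      using dist n ij by (simp_all add: nth_eq_iff_index_eq)
    moreover have "3 \<le> ?n" using len by (simp add: xs_def)
    ultimately show False using ij by (auto simp: mod_Suc split: if_splits)
  qed
  obtain a b where ab: "(a, b) \<in> parcs H" "a \<in> cycle_verts p" "b \<in> cycle_verts p"
    "(a, b) \<notin> set p" "(b, a) \<notin> set p" "a \<in> U" "b \<in> V"
  proof -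
    obtain e where e: "chord H p e" using p unfolding chorded_cycle_def by blast
    show thesis
    proof (cases "fst e \<in> U")
      case True
      then show ?thesis using that[of "fst e" "snd e"] e UV
        by (cases e) (auto simp: chord_def consecutive_on_def)
    next
      case False
      then show ?thesis using that[of "snd e" "fst e"] e UV
        by (cases e) (auto simp: chord_def consecutive_on_def)
    qed
  qed
  obtain y where y: "(b, y) \<in> set p" using ab(3) by (auto simp: cycle_verts_def)
  obtain x where x: "(x, b) \<in> set p" using ab(3) unfolding verts(2) by auto
  have "x \<in> U" "y \<in> U" using x y arcs UV ab(7) by auto
  moreover have "x \<in> cycle_verts p" using x by (force simp: cycle_verts_def)
  moreover have "y \<in> cycle_verts p" using y unfolding verts(2) by force
  ultimately have "{a, x, y} \<subseteq> cycle_verts p \<inter> U" using ab by blast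
  moreover have "card {a, x, y} = 3"
    using no_2cycle x y ab by (auto simp: card_insert_if)
  ultimately show ?thesis using fin by (metis card_mono finite_Int)
qed

lemma bipartite_degree:
  assumes UV: "U \<inter> V = {}" "parcs H = U \<times> V \<union> V \<times> U"
  shows "u \<in> U \<Longrightarrow> degree H u = card V" "v \<in> V \<Longrightarrow> degree H v = card U"
proof -
  show "degree H u = card V" if "u \<in> U"
  proof -
    have "out_arcs (with_proj H) u = Pair u ` V" using UV that by (auto simp: out_arcs_def)
    then show ?thesis by (simp add: out_degree_def card_image inj_on_def)
  qed
  show "degree H v = card U" if "v \<in> V"
  proof -
    have "out_arcs (with_proj H) v = Pair v ` U" using UV that by (auto simp: out_arcs_def)
    then show ?thesis by (simp add: out_degree_def card_image inj_on_def)
  qed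
qed

text \<open>The minimum is attained inside \<open>V\<close>, whose vertices have the smaller of the
  two degrees.\<close>

lemma sigma_complete_bipartite:
  assumes UV: "pverts H = U \<union> V" "U \<inter> V = {}" "parcs H = U \<times> V \<union> V \<times> U"
    and card: "card U \<le> card V" "t \<le> card V"
  shows "sigma t H = enat (t * card U)"
proof (rule antisym)
  obtain X where X: "X \<subseteq> V" "card X = t" using card(2) by (meson obtain_subset_with_card_n)
  then have "independent_set H X" using UV unfolding independent_set_def by blast
  then have "sigma t H \<le> enat (\<Sum>v\<in>X. degree H v)"
    unfolding sigma_def using X by (intro INF_lower) auto
  also have "(\<Sum>v\<in>X. degree H v) = t * card U"
    using X bipartite_degree(2)[OF UV(2,3)] by (simp add: subset_iff)
  finally show "sigma t H \<le> enat (t * card U)" .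
  show "enat (t * card U) \<le> sigma t H"
    unfolding sigma_def
  proof (rule INF_greatest)
    fix X assume "X \<in> {X. independent_set H X \<and> card X = t}"
    then have X: "X \<subseteq> U \<union> V" "card X = t" using UV(1) by (auto simp: independent_set_def)
    have "card X * card U \<le> (\<Sum>v\<in>X. degree H v)"
      using sum_bounded_below[of X "card U" "degree H"] bipartite_degree[OF UV(2,3)] X(1) card(1) by fastforce
    then show "enat (t * card U) \<le> enat (\<Sum>v\<in>X. degree H v)" using X(2) by simp
  qed
qed

lemma no_disjoint_chorded_cycles_bipartite:
  assumes UV: "U \<inter> V = {}" "parcs H = U \<times> V \<union> V \<times> U" "finite U" and card: "card U < 3 * k"
  shows "\<not> has_disjoint_chorded_cycles k H"
proof
  assume "has_disjoint_chorded_cycles k H"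
  then obtain C where C: "\<And>i. i < k \<Longrightarrow> chorded_cycle H (C i)"
    "disjoint_family_on (\<lambda>i. cycle_verts (C i)) {..<k}"
    unfolding has_disjoint_chorded_cycles_def by blast
  have "3 * k \<le> (\<Sum>i<k. card (cycle_verts (C i) \<inter> U))"
    using sum_bounded_below[of "{..<k}" 3 "\<lambda>i. card (cycle_verts (C i) \<inter> U)"]
      bipartite_chorded_cycle[OF UV(1,2) C(1) UV(3)] by simp
  also have "\<dots> = card (\<Union>i<k. cycle_verts (C i) \<inter> U)"
    using UV(3) C(2) unfolding disjoint_family_on_def by (intro card_UN_disjoint[symmetric]) auto
  also have "\<dots> \<le> card U" using UV(3) by (intro card_mono) auto
  finally show False using card by simp
qed

theorem theorem5:
  fixes k t :: nat
  assumes "k \<ge> 1" and "t \<ge> 1"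
  shows "(\<forall>G :: 'a pair_pre_digraph.
            pair_graph G
            \<and> card (pverts G) \<ge> (10 * t - 1) * (k - 1) + 12 * t + 13
            \<and> sigma t G \<ge> enat (3 * k * t - t + 1)
            \<longrightarrow> has_disjoint_chorded_cycles k G)
       \<and> (\<forall>\<^sub>F n in sequentially.
            \<forall>H :: 'b pair_pre_digraph. K\<^bsub>3 * k - 1, n - 3 * k + 1\<^esub> (with_proj H) \<longrightarrow>
              sigma t H = enat (t * (3 * k - 1))
              \<and> t * (3 * k - 1) = 3 * k * t - t
              \<and> \<not> has_disjoint_chorded_cycles k H)"
proof (intro conjI allI impI)
  fix G :: "'a pair_pre_digraph"
  assume "pair_graph G \<and> card (pverts G) \<ge> (10 * t - 1) * (k - 1) + 12 * t + 13
    \<and> sigma t G \<ge> enat (3 * k * t - t + 1)"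
  then show "has_disjoint_chorded_cycles k G"
    by (intro has_disjoint_chorded_cycles_if_sigma[OF assms]) auto
next
  show "\<forall>\<^sub>F n in sequentially.
            \<forall>H :: 'b pair_pre_digraph. K\<^bsub>3 * k - 1, n - 3 * k + 1\<^esub> (with_proj H) \<longrightarrow>
              sigma t H = enat (t * (3 * k - 1))
              \<and> t * (3 * k - 1) = 3 * k * t - t
              \<and> \<not> has_disjoint_chorded_cycles k H"
    using eventually_ge_at_top[of "6 * k + t"]
  proof (eventually_elim, intro allI impI)
    fix n and H :: "'b pair_pre_digraph"
    \<comment> \<open>From here on the second side has at least \<open>t\<close> vertices and is no
      smaller than the first.\<close>
    assume n: "6 * k + t \<le> n" and "K\<^bsub>3 * k - 1, n - 3 * k + 1\<^esub> (with_proj H)"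
    then obtain U V where fin: "finite (pverts H)" and
      UV: "pverts H = U \<union> V" "U \<inter> V = {}" "parcs H = U \<times> V \<union> V \<times> U"
      and card: "card U = 3 * k - 1" "card V = n - 3 * k + 1"
      unfolding complete_bipartite_digraph_pair_def by blast
    have "sigma t H = enat (t * (3 * k - 1))"
      using sigma_complete_bipartite[OF UV, of t] card n by simp
    moreover have "\<not> has_disjoint_chorded_cycles k H"
      by (rule no_disjoint_chorded_cycles_bipartite[OF UV(2,3)]) (use fin UV(1) card assms(1) in auto)
    moreover have "t * (3 * k - 1) = 3 * k * t - t"
      by (simp add: diff_mult_distrib2 mult.commute)
    ultimately show "sigma t H = enat (t * (3 * k - 1)) \<and> t * (3 * k - 1) = 3 * k * t - t
      \<and> \<not> has_disjoint_chorded_cycles k H" by blast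
  qed
qed

end
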